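(* Let $(X,\mu,S,T)$ be an ergodic measure preserving system with commuting invertible measure preserving transformations $S$ and $T$. Then for any $f_1,f_2,f_3\in L^{\infty}(\mu)$ the averages \[\frac{1}{N^2}\sum_{i,j=0}^{N-1} f_1(S^i x)\,f_2(T^j x)\,f_3(S^iT^j x)\] converge for $\mu$-almost every $x\in X$ as $N\to\infty$.
   Context: A system $(X,\mu,S,T)$ is a standard probability space $(X,\mu)$ with two commuting invertible measure preserving transformations $S,T$; it is ergodic if every set invariant under both $S$ and $T$ has measure $0$ or $1$. Functions are real valued. *)

theory Defs
  imports "HOL-Probability.Probability"
begin

definition mp_map :: "'a measure \<Rightarrow> ('a \<Rightarrow> 'a) \<Rightarrow> bool" where
  "mp_map M S \<longleftrightarrow> S \<in> measurable M M \<and> distr M M S = M"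

definition inv_mp_map :: "'a measure \<Rightarrow> ('a \<Rightarrow> 'a) \<Rightarrow> bool" where
  "inv_mp_map M S \<longleftrightarrow> bij_betw S (space M) (space M) \<and> mp_map M S
      \<and> mp_map M (inv_into (space M) S)"

definition ergodic2 :: "'a measure \<Rightarrow> ('a \<Rightarrow> 'a) \<Rightarrow> ('a \<Rightarrow> 'a) \<Rightarrow> bool" where
  "ergodic2 M S T \<longleftrightarrow> (\<forall>A \<in> sets M.
      S -` A \<inter> space M = A \<and> T -` A \<inter> space M = A
        \<longrightarrow> measure M A = 0 \<or> measure M A = 1)"

definition Linfty :: "'a measure \<Rightarrow> ('a \<Rightarrow> real) set" where
  "Linfty M = {f. f \<in> borel_measurable M \<and> (\<exists>C. AE x in M. \<bar>f x\<bar> \<le> C)}"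

end

theory Submission
  imports Defs
begin

text \<open>
  Let \<open>A\<^sub>N(f\<^sub>1, f\<^sub>2, v)\<close> be the averages. Bounding the average over \<open>[0,N)\<^sup>2\<close> by averages over small
  boxes and applying Cauchy-Schwarz twice in each box gives, for \<open>f\<^sub>1, f\<^sub>2\<close> bounded by 1,
  that \<open>limsup A\<^sub>N(f\<^sub>1, f\<^sub>2, v)\<^sup>2 \<le> \<integral> \<bar>E v\<bar> d\<nu>\<close>, where \<open>\<nu>\<close> is the self-joining of \<open>\<mu>\<close> relatively
  independent over the \<open>S\<close>-invariant sets and \<open>E v\<close> is the projection of \<open>v(x) v(y)\<close> to the
  \<open>T \<times> T\<close>-invariant functions. With \<open>K = sgn (E v)\<close> the bound is the inner product of \<open>v\<close> with
  the dual function \<open>x \<mapsto> \<integral> K(x,y) v(y) d\<nu>\<^sub>x(y)\<close>.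

  If \<open>f\<^sub>3\<close> is itself a function \<open>\<integral> K(x,y) g(y) d\<nu>\<^sub>x(y)\<close> with \<open>K\<close> invariant under \<open>T \<times> T\<close>, then the
  invariance of \<open>K\<close>, \<open>\<nu>\<^bsub>Tx\<^esub> = T \<nu>\<^sub>x\<close> and \<open>\<nu>\<^bsub>Sx\<^esub> = \<nu>\<^sub>x\<close> give \<open>f\<^sub>3(S\<^sup>iT\<^sup>jx) = \<integral> K(S\<^sup>ix,y) g(T\<^sup>jy) d\<nu>\<^sub>x(y)\<close>.
  So the average factors under the integral sign into an average of \<open>f\<^sub>1(x) K(x,y)\<close> along \<open>S \<times> id\<close> and
  one of \<open>f\<^sub>2(x) g(y)\<close> along \<open>T \<times> T\<close>, both of which converge by Birkhoff's theorem on \<open>\<nu>\<close>.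
  A general \<open>f\<^sub>3\<close> is approximated in \<open>L\<^sup>2\<close> by functions for which the averages converge.
\<close>

section \<open>Bounded measurable functions and the pointwise ergodic theorem\<close>

text \<open>The bound holds at every point, even outside \<open>space M\<close>, so estimates along
  orbits and on fibres carry no exceptional sets. Essentially bounded functions are replaced by such
  representatives at the end.\<close>

definition bmeas :: "'a measure \<Rightarrow> ('a \<Rightarrow> real) \<Rightarrow> bool" where
  "bmeas M f \<longleftrightarrow> f \<in> borel_measurable M \<and> (\<exists>C. \<forall>x. \<bar>f x\<bar> \<le> C)"

lemma bmeasI: "f \<in> borel_measurable M \<Longrightarrow> (\<And>x. \<bar>f x\<bar> \<le> C) \<Longrightarrow> bmeas M f"
  by (auto simp: bmeas_def)

lemma bmeas_measurable[measurable_dest]: "bmeas M f \<Longrightarrow> f \<in> borel_measurable M"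
  by (simp add: bmeas_def)

lemma bmeas_bound:
  assumes "bmeas M f"
  obtains C where "C \<ge> 0" "\<And>x. \<bar>f x\<bar> \<le> C"
  using assms unfolding bmeas_def by (metis abs_ge_zero order_trans)

lemma (in finite_measure) bmeas_integrable:
  "bmeas M f \<Longrightarrow> integrable M f"
  unfolding bmeas_def by (metis AE_I2 integrable_const_bound real_norm_def)

lemma bmeas_const: "bmeas M (\<lambda>x. c)"
  by (rule bmeasI[where C="\<bar>c\<bar>"]) auto

lemma bmeas_add:
  assumes "bmeas M f" "bmeas M g"
  shows "bmeas M (\<lambda>x. f x + g x)"
proof -
  obtain C D where "\<And>x. \<bar>f x\<bar> \<le> C" "\<And>x. \<bar>g x\<bar> \<le> D"
    using assms by (metis bmeas_bound)
  then have "\<bar>f x + g x\<bar> \<le> C + D" for x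
    by (metis abs_triangle_ineq add_mono order_trans)
  then show ?thesis
    using assms by (intro bmeasI) (auto dest: bmeas_measurable)
qed

lemma bmeas_mult:
  assumes "bmeas M f" "bmeas M g"
  shows "bmeas M (\<lambda>x. f x * g x)"
proof -
  obtain C D where *: "C \<ge> 0" "\<And>x. \<bar>f x\<bar> \<le> C" "\<And>x. \<bar>g x\<bar> \<le> D"
    using assms by (metis bmeas_bound)
  then have "\<bar>f x * g x\<bar> \<le> C * D" for x
    unfolding abs_mult by (intro mult_mono) auto
  then show ?thesis
    using assms by (intro bmeasI) (auto dest: bmeas_measurable)
qed

lemma bmeas_cmult: "bmeas M f \<Longrightarrow> bmeas M (\<lambda>x. c * f x)"
  by (intro bmeas_mult bmeas_const)

lemma bmeas_diff: "bmeas M f \<Longrightarrow> bmeas M g \<Longrightarrow> bmeas M (\<lambda>x. f x - g x)"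
  using bmeas_add[OF _ bmeas_cmult[of M g "-1"]] by simp

lemma bmeas_power2: "bmeas M f \<Longrightarrow> bmeas M (\<lambda>x. (f x)\<^sup>2)"
  unfolding power2_eq_square by (intro bmeas_mult)

lemma bmeas_abs: "bmeas M f \<Longrightarrow> bmeas M (\<lambda>x. \<bar>f x\<bar>)"
  unfolding bmeas_def by auto

lemma bmeas_sum: "(\<And>i. i \<in> I \<Longrightarrow> bmeas M (f i)) \<Longrightarrow> bmeas M (\<lambda>x. \<Sum>i\<in>I. f i x)"
  by (induction I rule: infinite_finite_induct) (auto intro: bmeas_const bmeas_add)

lemma bmeas_indicator: "A \<in> sets M \<Longrightarrow> bmeas M (indicator A)"
  by (rule bmeasI[where C=1]) (auto split: split_indicator)

lemma bmeas_compose: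
  "bmeas N f \<Longrightarrow> R \<in> measurable M N \<Longrightarrow> bmeas M (\<lambda>x. f (R x))"
  unfolding bmeas_def by auto

lemmas bmeas_intros = bmeas_const bmeas_add bmeas_mult bmeas_diff bmeas_power2 bmeas_abs
  bmeas_sum bmeas_indicator

section \<open>Measure preserving maps and averages along one orbit\<close>

lemma mp_mapD: "mp_map M R \<Longrightarrow> R \<in> measurable M M" "mp_map M R \<Longrightarrow> distr M M R = M"
  by (auto simp: mp_map_def)

lemma mp_map_integral:
  fixes f :: "'a \<Rightarrow> real"
  assumes "mp_map M R" "f \<in> borel_measurable M"
  shows "(\<integral>x. f (R x) \<partial>M) = integral\<^sup>L M f"
  using integral_distr[of R M M f] assms by (simp add: mp_map_def)

lemma mp_map_AE: "mp_map M R \<Longrightarrow> AE x in M. P x \<Longrightarrow> AE x in M. P (R x)"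
  using AE_distrD[of R M M P] unfolding mp_map_def by metis

lemma mp_map_comp: 
  assumes "mp_map M R" "mp_map M R'" shows "mp_map M (\<lambda>x. R (R' x))"
  using distr_distr[of R M M R' M] assms unfolding mp_map_def comp_def
  by (metis measurable_compose)

lemma mp_map_funpow: "mp_map M R \<Longrightarrow> mp_map M (R ^^ i)"
proof (induction i)
  case 0
  show ?case by (simp add: mp_map_def id_def distr_id2)
next
  case (Suc i)
  have "(R ^^ Suc i) = (\<lambda>x. R ((R ^^ i) x))" by auto
  then show ?case using mp_map_comp[OF Suc.prems Suc.IH] Suc.prems by simp
qed

lemmas funpow_measurable = mp_mapD(1)[OF mp_map_funpow]

definition ravg :: "('a \<Rightarrow> 'a) \<Rightarrow> ('a \<Rightarrow> real) \<Rightarrow> nat \<Rightarrow> 'a \<Rightarrow> real" where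
  "ravg R f N x = (\<Sum>i<N. f ((R ^^ i) x)) / real N"

lemma bmeas_ravg:
  assumes "mp_map M R" "bmeas M f"
  shows "bmeas M (ravg R f N)"
proof -
  have "bmeas M (\<lambda>x. (1 / real N) * (\<Sum>i<N. f ((R ^^ i) x)))"
    by (intro bmeas_mult bmeas_const bmeas_sum bmeas_compose[OF assms(2)] funpow_measurable assms)
  then show ?thesis by (simp add: ravg_def[abs_def])
qed

lemma abs_ravg_le:
  assumes "\<And>x. \<bar>f x\<bar> \<le> C"
  shows "\<bar>ravg R f N x\<bar> \<le> C"
proof (cases "N = 0")
  case True
  then show ?thesis using assms[of x] by (simp add: ravg_def) 
next
  case False
  have "\<bar>\<Sum>i<N. f ((R ^^ i) x)\<bar> \<le> (\<Sum>i<N. C)"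
    by (rule order_trans[OF sum_abs sum_mono]) (simp add: assms)
  then show ?thesis using False by (simp add: ravg_def field_simps)
qed

lemma ravg_cmult: "ravg R (\<lambda>x. c * f x) N x = c * ravg R f N x"
  by (simp add: ravg_def sum_distrib_left)

lemma ravg_diff: "ravg R (\<lambda>x. f x - g x) N x = ravg R f N x - ravg R g N x"
  by (simp add: ravg_def sum_subtractf diff_divide_distrib)

lemma ravg_mono: "(\<And>x. f x \<le> g x) \<Longrightarrow> ravg R f N x \<le> ravg R g N x"
  by (simp add: ravg_def divide_right_mono sum_mono)

lemma ravg_const: "N > 0 \<Longrightarrow> ravg R (\<lambda>x. c) N x = c"
  by (simp add: ravg_def)

text \<open>The difference of the two sums telescopes to two end terms.\<close>

lemma ravg_shift:
  assumes "\<And>x. \<bar>f x\<bar> \<le> C"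
  shows "\<bar>ravg R f N (R x) - ravg R f N x\<bar> \<le> 2 * C / real N"
proof -
  have "(\<Sum>i<N. f ((R ^^ i) (R x))) - (\<Sum>i<N. f ((R ^^ i) x)) = (\<Sum>i<N. f ((R ^^ Suc i) x) - f ((R ^^ i) x))"
    by (simp add: sum_subtractf funpow_swap1)
  also have "\<dots> = f ((R ^^ N) x) - f x"
    by (subst sum_lessThan_telescope) simp
  finally have "ravg R f N (R x) - ravg R f N x = (f ((R ^^ N) x) - f x) / real N"
    by (simp add: ravg_def diff_divide_distrib [symmetric])
  moreover have "\<bar>f ((R ^^ N) x) - f x\<bar> \<le> 2 * C"
    using assms[of x] assms[of "(R ^^ N) x"] by linarith
  ultimately show ?thesis
    by (simp add: divide_right_mono)
qed

lemma ravg_shift_tendsto: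
  assumes "\<And>x. \<bar>f x\<bar> \<le> C"
  shows "(\<lambda>N. ravg R f N (R x) - ravg R f N x) \<longlonglongrightarrow> 0"
proof (rule Lim_null_comparison)
  show "\<forall>\<^sub>F N in sequentially. norm (ravg R f N (R x) - ravg R f N x) \<le> 2 * C / real N"
    using ravg_shift[of f C R _ x, OF assms] by simp
  show "(\<lambda>N. 2 * C / real N) \<longlonglongrightarrow> 0"
    by (intro real_tendsto_divide_at_top[OF tendsto_const] filterlim_real_sequentially)
qed

section \<open>Maxima of partial sums and the maximal ergodic inequality\<close>

fun maxsum :: "('a \<Rightarrow> 'a) \<Rightarrow> ('a \<Rightarrow> real) \<Rightarrow> nat \<Rightarrow> 'a \<Rightarrow> real" where
  "maxsum R g 0 x = 0"
| "maxsum R g (Suc n) x = max 0 (g x + maxsum R g n (R x))"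

lemma maxsum_nonneg: "maxsum R g n x \<ge> 0"
  by (cases n) auto

lemma maxsum_mono: "maxsum R g n x \<le> maxsum R g (Suc n) x"
proof (induction n arbitrary: x)
  case (Suc n)
  have "maxsum R g (Suc n) x = max 0 (g x + maxsum R g n (R x))" by simp
  also have "\<dots> \<le> max 0 (g x + maxsum R g (Suc n) (R x))"
    using Suc[of "R x"] by (intro max.mono) auto
  finally show ?case by simp
qed simp

text \<open>Unrolling the recursion shows \<open>maxsum R g n x\<close> to be the maximum over k
  \<le> n of the sums of the first k terms, k = 0 included; each step peels off the first
  term.\<close>

lemma maxsum_ge: "(\<Sum>i<n. g ((R ^^ i) x)) \<le> maxsum R g n x"
proof (induction n arbitrary: x)
  case (Suc n)
  have "(\<Sum>i<Suc n. g ((R ^^ i) x)) = g x + (\<Sum>i<n. g ((R ^^ i) (R x)))"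
    by (subst sum.lessThan_Suc_shift) (simp add: funpow_swap1)
  then show ?case using Suc[of "R x"] by simp
qed simp

lemma bmeas_maxsum:
  assumes "mp_map M R" "bmeas M g"
  shows "bmeas M (maxsum R g n)"
proof (induction n)
  case 0
  have "maxsum R g 0 = (\<lambda>x. 0)" by auto
  then show ?case by (simp add: bmeas_const)
next
  case (Suc n)
  have "bmeas M (\<lambda>x. g x + maxsum R g n (R x))"
    by (intro bmeas_add bmeas_compose[OF Suc] mp_mapD assms)
  then have "bmeas M (\<lambda>x. max 0 (g x + maxsum R g n (R x)))"
    unfolding bmeas_def
  proof (safe; (elim exI)?)
    fix C assume "\<forall>x. \<bar>g x + maxsum R g n (R x)\<bar> \<le> C"
    then have "\<forall>x. \<bar>max 0 (g x + maxsum R g n (R x))\<bar> \<le> C"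
      by (metis abs_ge_zero abs_le_iff abs_of_nonneg max.bounded_iff max.cobounded1 max_def order_trans)
    then show "\<exists>C. \<forall>x. \<bar>max 0 (g x + maxsum R g n (R x))\<bar> \<le> C" ..
  qed simp
  moreover have "maxsum R g (Suc n) = (\<lambda>x. max 0 (g x + maxsum R g n (R x)))" by auto
  ultimately show ?case by simp
qed

text \<open>Garsia's argument for the maximal ergodic inequality.\<close>

lemma (in prob_space) maximal_ergodic:
  assumes R: "mp_map M R" and g: "bmeas M g"
    and pos: "\<And>x. x \<in> space M \<Longrightarrow> \<exists>k. (\<Sum>i<k. g ((R ^^ i) x)) > 0"
  shows "(\<integral>x. g x \<partial>M) \<ge> 0"
proof -
  note [measurable] = mp_mapD(1)[OF R] bmeas_measurable[OF g] bmeas_measurable[OF bmeas_maxsum[OF R g]]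
  define E where "E n = {x \<in> space M. maxsum R g n x > 0}" for n
  have E[measurable]: "E n \<in> sets M" for n unfolding E_def by measurable
  have nonneg: "(\<integral>x. indicator (E n) x * g x \<partial>M) \<ge> 0" for n
  proof -
    have m: "bmeas M (maxsum R g n)" and mR: "bmeas M (\<lambda>x. maxsum R g n (R x))"
      by (auto intro!: bmeas_maxsum bmeas_compose[OF bmeas_maxsum] mp_mapD g R)
    have "0 = (\<integral>x. maxsum R g n x \<partial>M) - (\<integral>x. maxsum R g n (R x) \<partial>M)"
      by (simp add: mp_map_integral[OF R])
    also have "\<dots> = (\<integral>x. maxsum R g n x - maxsum R g n (R x) \<partial>M)"
      by (intro Bochner_Integration.integral_diff[symmetric] bmeas_integrable m mR)
    also have "\<dots> \<le> (\<integral>x. indicator (E n) x * g x \<partial>M)"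
    proof (rule integral_mono)
      show "integrable M (\<lambda>x. maxsum R g n x - maxsum R g n (R x))"
        by (intro bmeas_integrable bmeas_diff m mR)
      show "integrable M (\<lambda>x. indicator (E n) x * g x)"
        by (intro bmeas_integrable bmeas_intros g) measurable
      fix x assume x: "x \<in> space M"
      show "maxsum R g n x - maxsum R g n (R x) \<le> indicator (E n) x * g x"
      proof (cases "maxsum R g n x > 0")
        case True
        \<comment> \<open>The larger maximum is positive too, so it is attained by
          \<open>g x + maxsum R g n (R x)\<close> and not by the empty sum.\<close>
        have "maxsum R g n x \<le> maxsum R g (Suc n) x" by (rule maxsum_mono)
        with True have "maxsum R g n x \<le> g x + maxsum R g n (R x)" by auto
        then show ?thesis using True x by (simp add: E_def)
      next
        case False
        then have "maxsum R g n x = 0" using maxsum_nonneg[of R g n x] by linarith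
        then show ?thesis using maxsum_nonneg[of R g n "R x"] x by (simp add: E_def)
      qed
    qed
    finally show ?thesis .
  qed
  obtain C where C: "\<And>x. \<bar>g x\<bar> \<le> C" using g by (metis bmeas_bound)
  \<comment> \<open>By \<open>pos\<close> every point lies in \<open>E n\<close> for all large n, so
    the integrals over \<open>E n\<close> exhaust the integral of g.\<close>
  have "(\<lambda>n. \<integral>x. indicator (E n) x * g x \<partial>M) \<longlonglongrightarrow> (\<integral>x. g x \<partial>M)"
  proof (rule integral_dominated_convergence[where w="\<lambda>x. C"])
    show "AE x in M. (\<lambda>n. indicator (E n) x * g x) \<longlonglongrightarrow> g x"
    proof (rule AE_I2)
      fix x assume x: "x \<in> space M"
      then obtain k where k: "(\<Sum>i<k. g ((R ^^ i) x)) > 0" using pos by blast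
      have "x \<in> E n" if "n \<ge> k" for n
      proof -
        have "maxsum R g k x \<le> maxsum R g n x"
          using that by (rule lift_Suc_mono_le[of "\<lambda>n. maxsum R g n x", OF maxsum_mono])
        then show ?thesis using maxsum_ge[of g R x k] k x by (simp add: E_def)
      qed
      then have "eventually (\<lambda>n. indicator (E n) x * g x = g x) sequentially"
        unfolding eventually_sequentially by (auto intro!: exI[of _ k])
      then show "(\<lambda>n. indicator (E n) x * g x) \<longlonglongrightarrow> g x"
        by (rule tendsto_eventually)
    qed
    show "AE x in M. norm (indicator (E n) x * g x) \<le> C" for n
      using C by (auto split: split_indicator intro: order_trans[OF abs_ge_zero])
  qed auto
  then show ?thesis using nonneg by (intro LIMSEQ_le_const) auto
qed

section \<open>Upper limits of averages and Birkhoff's theorem\<close>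

definition rlimsup :: "(nat \<Rightarrow> real) \<Rightarrow> real" where
  "rlimsup X = real_of_ereal (limsup (\<lambda>n. ereal (X n)))"

text \<open>A bounded sequence has a finite upper limit, so \<open>real_of_ereal\<close>, which
  sends infinite values to 0, loses nothing.\<close>

lemma ereal_rlimsup:
  assumes "\<And>n. \<bar>X n\<bar> \<le> C"
  shows "ereal (rlimsup X) = limsup (\<lambda>n. ereal (X n))"
proof -
  have "limsup (\<lambda>n. ereal (X n)) \<le> ereal C"
    using assms by (intro Limsup_bounded) (simp add: abs_le_iff)
  moreover have "ereal (-C) \<le> limsup (\<lambda>n. ereal (X n))"
  proof (rule order_trans)
    show "ereal (-C) \<le> liminf (\<lambda>n. ereal (X n))"
      using assms by (intro Liminf_bounded always_eventually) (auto simp: abs_le_iff minus_le_iff)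
  qed (simp add: Liminf_le_Limsup)
  ultimately show ?thesis unfolding rlimsup_def by (intro ereal_real') auto
qed

lemma abs_rlimsup_le:
  assumes "\<And>n. \<bar>X n\<bar> \<le> C"
  shows "\<bar>rlimsup X\<bar> \<le> C"
proof -
  have "limsup (\<lambda>n. ereal (X n)) \<le> ereal C"
    using assms by (intro Limsup_bounded) (simp add: abs_le_iff)
  moreover have "ereal (-C) \<le> limsup (\<lambda>n. ereal (X n))"
  proof (rule order_trans)
    show "ereal (-C) \<le> liminf (\<lambda>n. ereal (X n))"
      using assms by (intro Liminf_bounded always_eventually) (auto simp: abs_le_iff minus_le_iff)
  qed (simp add: Liminf_le_Limsup)
  ultimately show ?thesis using ereal_rlimsup[of X C, OF assms] ereal_less_eq(3)
    by (metis abs_le_iff minus_le_iff)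
qed

text \<open>Otherwise the upper limit would be at most \<open>rlimsup X - e\<close>. The index is
  positive because an average over no terms carries no information.\<close>

lemma rlimsup_frequently:
  assumes "\<And>n. \<bar>X n\<bar> \<le> C" "e > 0"
  shows "\<exists>k>0. X k > rlimsup X - e"
proof (rule ccontr)
  assume "\<not> ?thesis"
  then have "X n \<le> rlimsup X - e" if "n \<ge> 1" for n
    using that by (metis not_less not_one_le_zero gr0I)
  then have "eventually (\<lambda>n. ereal (X n) \<le> ereal (rlimsup X - e)) sequentially"
    unfolding eventually_sequentially by auto
  then have "limsup (\<lambda>n. ereal (X n)) \<le> ereal (rlimsup X - e)"
    by (rule Limsup_bounded)
  then have "ereal (rlimsup X) \<le> ereal (rlimsup X - e)"
    using ereal_rlimsup[of X C, OF assms(1)] by simp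
  then show False using assms(2) by simp
qed

lemma rlimsup_eq_of_diff_tendsto:
  assumes "(\<lambda>n. X n - Y n) \<longlonglongrightarrow> 0"
  shows "rlimsup X = rlimsup Y"
proof -
  have "limsup (\<lambda>n. ereal (X n)) = limsup (\<lambda>n. ereal (X n - Y n) + ereal (Y n))" by simp
  also have "\<dots> = 0 + limsup (\<lambda>n. ereal (Y n))"
    using assms by (intro ereal_limsup_lim_add) (auto simp: zero_ereal_def)
  finally show ?thesis by (simp add: rlimsup_def)
qed

text \<open>The upper limit u is invariant, and at every point some average exceeds u - e. The
  maximal inequality for f - u + e then bounds the integral of u by that of f plus e.\<close>

lemma (in prob_space) integral_rlimsup_ravg_le:
  assumes R: "mp_map M R" and f: "bmeas M f"
  shows "bmeas M (\<lambda>x. rlimsup (\<lambda>N. ravg R f N x))"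
    and "(\<integral>x. rlimsup (\<lambda>N. ravg R f N x) \<partial>M) \<le> integral\<^sup>L M f"
proof -
  obtain C where C: "\<And>x. \<bar>f x\<bar> \<le> C" using f by (metis bmeas_bound)
  define u where "u x = rlimsup (\<lambda>N. ravg R f N x)" for x
  have u: "bmeas M u"
  proof (rule bmeasI)
    have [measurable]: "ravg R f N \<in> borel_measurable M" for N
      by (intro bmeas_measurable bmeas_ravg R f)
    show "u \<in> borel_measurable M"
      unfolding u_def[abs_def] rlimsup_def by measurable
    show "\<bar>u x\<bar> \<le> C" for x unfolding u_def by (intro abs_rlimsup_le abs_ravg_le C)
  qed
  then show "bmeas M (\<lambda>x. rlimsup (\<lambda>N. ravg R f N x))" by (simp add: u_def[abs_def])
  have uR: "u (R x) = u x" for x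
    unfolding u_def by (rule rlimsup_eq_of_diff_tendsto) (rule ravg_shift_tendsto[OF C])
  have uRi: "u ((R ^^ i) x) = u x" for i x
    by (induction i) (auto simp: uR)
  have "integral\<^sup>L M u \<le> integral\<^sup>L M f + e" if e: "e > 0" for e
  proof -
    have "0 \<le> (\<integral>x. f x - u x + e \<partial>M)"
    proof (rule maximal_ergodic[OF R])
      show "bmeas M (\<lambda>x. f x - u x + e)" by (intro bmeas_intros f u)
      fix x
      obtain k where k: "k > 0" "ravg R f k x > u x - e"
        using rlimsup_frequently[of "\<lambda>N. ravg R f N x" C e, OF abs_ravg_le[of f C, OF C] e]
        unfolding u_def by blast
      then have "(\<Sum>i<k. f ((R ^^ i) x)) - real k * u x + real k * e > 0"
        by (simp add: ravg_def field_simps)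
      then show "\<exists>k. 0 < (\<Sum>i<k. f ((R ^^ i) x) - u ((R ^^ i) x) + e)"
        by (intro exI[of _ k]) (simp add: uRi sum.distrib sum_subtractf)
    qed
    then show ?thesis
      using bmeas_integrable[OF f] bmeas_integrable[OF u] by (simp add: prob_space)
  qed
  then show "(\<integral>x. rlimsup (\<lambda>N. ravg R f N x) \<partial>M) \<le> integral\<^sup>L M f"
    unfolding u_def by (rule field_le_epsilon)
qed

text \<open>Applied to f and to -f, the preceding bound places the integral of f above that of the
  upper limit and below that of the lower limit. As the lower limit is at most the upper one, they
  agree almost everywhere.\<close>

theorem (in prob_space) birkhoff:
  assumes R: "mp_map M R" and f: "bmeas M f"
  shows "AE x in M. convergent (\<lambda>N. ravg R f N x)"
proof -
  obtain C where C: "\<And>x. \<bar>f x\<bar> \<le> C" using f by (metis bmeas_bound)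
  have f': "bmeas M (\<lambda>x. - f x)" using bmeas_cmult[OF f, of "-1"] by simp
  have neg: "ravg R (\<lambda>x. - f x) N x = - ravg R f N x" for N x
    using ravg_cmult[of R "-1" f] by simp
  define u where "u x = rlimsup (\<lambda>N. ravg R f N x)" for x
  define w where "w x = rlimsup (\<lambda>N. - ravg R f N x)" for x
  have u: "bmeas M u" "integral\<^sup>L M u \<le> integral\<^sup>L M f"
    using integral_rlimsup_ravg_le[OF R f] by (auto simp: u_def[abs_def])
  have w: "bmeas M w" "integral\<^sup>L M w \<le> - integral\<^sup>L M f"
    using integral_rlimsup_ravg_le[OF R f'] by (auto simp: w_def[abs_def] neg)
  have bd: "\<bar>ravg R f N x\<bar> \<le> C" "\<bar>- ravg R f N x\<bar> \<le> C" for N x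
    using abs_ravg_le[OF C] by auto
  have ew: "ereal (- w x) = liminf (\<lambda>N. ereal (ravg R f N x))" for x
  proof -
    have "ereal (w x) = limsup (\<lambda>N. - ereal (ravg R f N x))"
      using ereal_rlimsup[OF bd(2)] by (simp add: w_def)
    also have "\<dots> = - liminf (\<lambda>N. ereal (ravg R f N x))" by (rule ereal_Limsup_uminus)
    finally show ?thesis by (metis ereal_uminus_uminus uminus_ereal.simps(1))
  qed
  have eu: "ereal (u x) = limsup (\<lambda>N. ereal (ravg R f N x))" for x
    using ereal_rlimsup[OF bd(1)] by (simp add: u_def)
  have ge: "u x + w x \<ge> 0" for x
  proof -
    have "ereal (- w x) \<le> ereal (u x)" unfolding ew eu by (simp add: Liminf_le_Limsup)
    then show ?thesis by simp
  qed
  have "(\<integral>x. u x + w x \<partial>M) \<le> 0"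
    using u w bmeas_integrable by simp
  moreover have "(\<integral>x. u x + w x \<partial>M) \<ge> 0" by (intro integral_nonneg_AE AE_I2 ge)
  ultimately have "(\<integral>x. u x + w x \<partial>M) = 0" by simp
  then have "AE x in M. u x + w x = 0"
    using integral_nonneg_eq_0_iff_AE[of M "\<lambda>x. u x + w x"] ge u w bmeas_integrable by auto
  then show ?thesis
  proof (rule AE_mp, intro AE_I2 impI)
    fix x assume "u x + w x = 0"
    then have "- w x = u x" by simp
    then have "(\<lambda>N. ereal (ravg R f N x)) \<longlonglongrightarrow> ereal (u x)"
      using ew[of x] eu[of x] by (intro Liminf_eq_Limsup) auto
    then show "convergent (\<lambda>N. ravg R f N x)"
      by (auto simp: convergent_def)
  qed
qed

section \<open>Limits of ergodic averages\<close>

text \<open>For bounded f the default 0 at points of divergence makes \<open>erg R f\<close> bounded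
  and R-invariant at every point. It is a version of the conditional expectation of f given the
  R-invariant sets.\<close>

definition erg :: "('a \<Rightarrow> 'a) \<Rightarrow> ('a \<Rightarrow> real) \<Rightarrow> 'a \<Rightarrow> real" where
  "erg R f x = (if convergent (\<lambda>N. ravg R f N x) then lim (\<lambda>N. ravg R f N x) else 0)"

lemma erg_eqI: "(\<lambda>N. ravg R f N x) \<longlonglongrightarrow> l \<Longrightarrow> erg R f x = l"
  by (auto simp: erg_def limI convergent_def)

lemma erg_tendsto: "convergent (\<lambda>N. ravg R f N x) \<Longrightarrow> (\<lambda>N. ravg R f N x) \<longlonglongrightarrow> erg R f x"
  by (simp add: erg_def convergent_LIMSEQ_iff)

lemma (in prob_space) AE_erg:
  "mp_map M R \<Longrightarrow> bmeas M f \<Longrightarrow> AE x in M. (\<lambda>N. ravg R f N x) \<longlonglongrightarrow> erg R f x"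
  using birkhoff[of R f] by (auto intro: erg_tendsto)

lemma abs_erg_le:
  assumes "\<And>x. \<bar>f x\<bar> \<le> C"
  shows "\<bar>erg R f x\<bar> \<le> C"
proof (cases "convergent (\<lambda>N. ravg R f N x)")
  case True
  have "(\<lambda>N. \<bar>ravg R f N x\<bar>) \<longlonglongrightarrow> \<bar>erg R f x\<bar>"
    by (intro tendsto_rabs erg_tendsto True)
  then show ?thesis
    by (rule LIMSEQ_le_const2) (use abs_ravg_le[of f, OF assms] in auto)
next
  case False
  then show ?thesis using order_trans[OF abs_ge_zero assms] by (simp add: erg_def)
qed

lemma erg_nonneg:
  assumes "\<And>x. f x \<ge> 0"
  shows "erg R f x \<ge> 0"
proof (cases "convergent (\<lambda>N. ravg R f N x)")
  case True
  show ?thesis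
    by (rule LIMSEQ_le_const[OF erg_tendsto[OF True]]) (auto simp: ravg_def assms sum_nonneg)
qed (simp add: erg_def)

lemma bmeas_erg:
  assumes "mp_map M R" "bmeas M f"
  shows "bmeas M (erg R f)"
proof -
  obtain C where C: "\<And>x. \<bar>f x\<bar> \<le> C" using assms by (metis bmeas_bound)
  have [measurable]: "ravg R f N \<in> borel_measurable M" for N
    by (intro bmeas_measurable bmeas_ravg assms)
  \<comment> \<open>Convergence is restated as the Cauchy property, a countable condition and hence
    a measurable one.\<close>
  have "erg R f \<in> borel_measurable M"
    unfolding erg_def[abs_def] convergent_def Cauchy_convergent_iff[symmetric, unfolded convergent_def]
    by measurable
  then show ?thesis by (rule bmeasI) (rule abs_erg_le[of f, OF C])
qed

text \<open>The averages at \<open>R x\<close> and at \<open>x\<close> differ by a null sequence, so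
  both converge, to the same limit, or both diverge and the two sides are the default.\<close>

lemma erg_invariant:
  assumes "bmeas M f"
  shows "erg R f (R x) = erg R f x"
proof -
  obtain C where "\<And>x. \<bar>f x\<bar> \<le> C" using assms by (metis bmeas_bound)
  then have d: "(\<lambda>N. ravg R f N (R x) - ravg R f N x) \<longlonglongrightarrow> 0"
    by (rule ravg_shift_tendsto)
  have 1: "(\<lambda>N. ravg R f N (R x)) \<longlonglongrightarrow> l" if "(\<lambda>N. ravg R f N x) \<longlonglongrightarrow> l" for l
    using tendsto_add[OF d that] by simp
  have 2: "(\<lambda>N. ravg R f N x) \<longlonglongrightarrow> l" if "(\<lambda>N. ravg R f N (R x)) \<longlonglongrightarrow> l" for l
    using tendsto_diff[OF that d] by simp
  show ?thesis
  proof (cases "convergent (\<lambda>N. ravg R f N x)")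
    case True
    show ?thesis by (rule erg_eqI[OF 1[OF erg_tendsto[OF True]]])
  next
    case False
    then have "\<not> convergent (\<lambda>N. ravg R f N (R x))" using 2 by (auto simp: convergent_def)
    then show ?thesis using False by (simp add: erg_def)
  qed
qed

section \<open>Limits of averages under commuting maps, and as conditional expectations\<close>

lemma funpow_commute:
  assumes "\<And>x. T (R x) = R (T x)"
  shows "T ((R ^^ i) x) = (R ^^ i) (T x)"
  by (induction i) (auto simp: assms)

lemma funpow_commute2:
  assumes "\<And>x. T (R x) = R (T x)"
  shows "(T ^^ j) ((R ^^ i) x) = (R ^^ i) ((T ^^ j) x)"
  by (induction j) (auto simp: funpow_commute[of T R, OF assms])

lemma ravg_commute:
  assumes "\<And>x. T (R x) = R (T x)"
  shows "ravg R (\<lambda>x. f (T x)) N x = ravg R f N (T x)"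
  by (simp add: ravg_def funpow_commute[of T R, OF assms])

lemma erg_commute:
  assumes "\<And>x. T (R x) = R (T x)"
  shows "erg R (\<lambda>x. f (T x)) x = erg R f (T x)"
  by (simp add: erg_def ravg_commute[of T R, OF assms])

lemma (in prob_space) integral_ravg:
  assumes R: "mp_map M R" and f: "bmeas M f" and "N > 0"
  shows "(\<integral>x. ravg R f N x \<partial>M) = integral\<^sup>L M f"
proof -
  have "(\<integral>x. ravg R f N x \<partial>M) = (\<Sum>i<N. \<integral>x. f ((R ^^ i) x) \<partial>M) / real N"
    unfolding ravg_def
    by (subst Bochner_Integration.integral_divide_zero, subst Bochner_Integration.integral_sum)
       (auto intro!: bmeas_integrable bmeas_compose[OF f] funpow_measurable R)
  also have "\<dots> = integral\<^sup>L M f"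
    using \<open>N > 0\<close> by (simp add: mp_map_integral[OF mp_map_funpow[OF R]] bmeas_measurable[OF f])
  finally show ?thesis .
qed

lemma (in prob_space) tendsto_integral_bounded:
  assumes "\<And>n. bmeas M (u n)" "bmeas M v" "\<And>n x. \<bar>u n x\<bar> \<le> C"
    and "AE x in M. (\<lambda>n. u n x) \<longlonglongrightarrow> v x"
  shows "(\<lambda>n. \<integral>x. u n x \<partial>M) \<longlonglongrightarrow> (\<integral>x. v x \<partial>M)"
  by (rule integral_dominated_convergence[where w="\<lambda>_. C"])
     (use assms in \<open>auto intro: bmeas_measurable\<close>)

lemma (in prob_space) tendsto_integral_mult_ravg:
  assumes R: "mp_map M R" and f: "bmeas M f" and h: "bmeas M h"
  shows "(\<lambda>N. \<integral>x. h x * ravg R f N x \<partial>M) \<longlonglongrightarrow> (\<integral>x. h x * erg R f x \<partial>M)"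
proof -
  obtain C D where C: "\<And>x. \<bar>f x\<bar> \<le> C" and D: "D \<ge> 0" "\<And>x. \<bar>h x\<bar> \<le> D" using f h by (metis bmeas_bound)
  show ?thesis
  proof (rule tendsto_integral_bounded)
    show "\<bar>h x * ravg R f N x\<bar> \<le> D * C" for N x
      unfolding abs_mult by (intro mult_mono D abs_ravg_le C) auto
    show "AE x in M. (\<lambda>N. h x * ravg R f N x) \<longlonglongrightarrow> h x * erg R f x"
      using AE_erg[OF R f] by (auto intro: tendsto_mult_left)
  qed (auto intro!: bmeas_mult h bmeas_erg bmeas_ravg R f)
qed

text \<open>An invariant h passes inside the averages, and averaging preserves the integral; then N
  tends to infinity. This is the defining property of conditional expectation.\<close>

lemma (in prob_space) integral_invariant_mult_erg:
  assumes R: "mp_map M R" and f: "bmeas M f" and h: "bmeas M h" and inv: "\<And>x. h (R x) = h x"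
  shows "(\<integral>x. h x * erg R f x \<partial>M) = (\<integral>x. h x * f x \<partial>M)"
proof -
  have inv': "h ((R ^^ i) x) = h x" for i x by (induction i) (auto simp: inv)
  have "(\<integral>x. h x * ravg R f N x \<partial>M) = (\<integral>x. h x * f x \<partial>M)" if "N > 0" for N
  proof -
    have "(\<integral>x. h x * ravg R f N x \<partial>M) = (\<integral>x. ravg R (\<lambda>x. h x * f x) N x \<partial>M)"
      by (simp add: ravg_def inv' sum_distrib_left)
    then show ?thesis using integral_ravg[OF R bmeas_mult[OF h f] that] by simp
  qed
  then have "(\<lambda>N. \<integral>x. h x * ravg R f N x \<partial>M) \<longlonglongrightarrow> (\<integral>x. h x * f x \<partial>M)"
    by (intro tendsto_eventually eventually_mono[OF eventually_gt_at_top[of 0]])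
  then show ?thesis
    using tendsto_integral_mult_ravg[OF R f h] LIMSEQ_unique by blast
qed

lemma (in prob_space) integral_erg:
  assumes "mp_map M R" "bmeas M f"
  shows "(\<integral>x. erg R f x \<partial>M) = integral\<^sup>L M f"
  using integral_invariant_mult_erg[OF assms bmeas_const[of M 1]] by simp

text \<open>Both sides equal the integral of \<open>erg R f x * erg R g x\<close>: the projection is
  self-adjoint.\<close>

lemma (in prob_space) integral_erg_swap:
  assumes R: "mp_map M R" and f: "bmeas M f" and g: "bmeas M g"
  shows "(\<integral>x. f x * erg R g x \<partial>M) = (\<integral>x. erg R f x * g x \<partial>M)"
  using integral_invariant_mult_erg[OF R f bmeas_erg[OF R g] erg_invariant[OF g]]
    integral_invariant_mult_erg[OF R g bmeas_erg[OF R f] erg_invariant[OF f]]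
  by (simp add: mult.commute)

text \<open>With c the mean of h, the sets where h > c and where h < c are invariant, and measure 1
  for either would contradict that c is the mean. Invariance of h is pointwise because
  \<open>ergodic2\<close> speaks of exactly invariant sets.\<close>

lemma (in prob_space) ergodic2_const:
  assumes S: "mp_map M S" and T: "mp_map M T" and erg: "ergodic2 M S T"
    and h: "bmeas M h" "\<And>x. h (S x) = h x" "\<And>x. h (T x) = h x"
  shows "AE x in M. h x = integral\<^sup>L M h"
proof -
  note [measurable] = bmeas_measurable[OF h(1)]
  define c where "c = integral\<^sup>L M h"
  have 01: "prob A = 0 \<or> prob A = 1" if A: "A = {x \<in> space M. P (h x)}" "A \<in> sets M" for A P
  proof -
    have "S -` A \<inter> space M = A" "T -` A \<inter> space M = A"
      using measurable_space[OF mp_mapD(1)[OF S]] measurable_space[OF mp_mapD(1)[OF T]]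
      by (auto simp: A(1) h)
    then show ?thesis using erg A(2) unfolding ergodic2_def by blast
  qed
  have gt: "AE x in M. \<not> h x > c"
  proof -
    let ?A = "{x \<in> space M. h x > c}"
    have m: "?A \<in> sets M" by measurable
    have "prob ?A \<noteq> 1"
    proof
      assume "prob ?A = 1"
      then have "AE x in M. h x > c" using prob_Collect_eq_1[OF m] by simp
      then have "expectation h > c"
        by (intro expectation_greater bmeas_integrable h)
      then show False by (simp add: c_def)
    qed
    then have "prob ?A = 0" using 01[OF refl m] by blast
    then show ?thesis using prob_Collect_eq_0[OF m] by simp
  qed
  have lt: "AE x in M. \<not> h x < c"
  proof -
    let ?A = "{x \<in> space M. h x < c}"
    have m: "?A \<in> sets M" by measurable
    have "prob ?A \<noteq> 1"
    proof
      assume "prob ?A = 1"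
      then have "AE x in M. h x < c" using prob_Collect_eq_1[OF m] by simp
      then have "expectation h < c"
        by (intro expectation_less bmeas_integrable h)
      then show False by (simp add: c_def)
    qed
    then have "prob ?A = 0" using 01[OF refl m] by blast
    then show ?thesis using prob_Collect_eq_0[OF m] by simp
  qed
  from gt lt show ?thesis unfolding c_def[symmetric] by eventually_elim auto
qed

text \<open>The inner averages tend to \<open>h = erg T F\<close>, and the S-averages of h to a
  function invariant under both maps, hence to the integral of F. The inner average varies with N,
  so its error for all N \<ge> n is bounded by the tail supremum \<open>r n\<close>. The S-averages
  of \<open>r n\<close> tend to \<open>q n\<close>, and the integrals of \<open>q n\<close> and
  \<open>r n\<close> coincide and tend to 0; thus the infimum of the \<open>q n\<close> vanishes
  almost everywhere.\<close>

lemma (in prob_space) AE_ravg_ravg: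
  assumes S: "mp_map M S" and T: "mp_map M T" and comm: "\<And>x. S (T x) = T (S x)"
    and erg: "ergodic2 M S T" and F: "bmeas M F"
  shows "AE x in M. (\<lambda>N. ravg S (ravg T F N) N x) \<longlonglongrightarrow> integral\<^sup>L M F"
proof -
  obtain C where C: "C \<ge> 0" "\<And>x. \<bar>F x\<bar> \<le> C" using F by (metis bmeas_bound)
  define h where "h = erg T F"
  have h: "bmeas M h" unfolding h_def by (intro bmeas_erg T F)
  have hb: "\<bar>h x\<bar> \<le> C" for x unfolding h_def by (intro abs_erg_le C)
  have hF: "integral\<^sup>L M F = integral\<^sup>L M (erg S h)"
    using integral_erg[OF S h] integral_erg[OF T F] by (simp add: h_def)
  define d where "d N x = \<bar>ravg T F N x - h x\<bar>" for N x
  have d: "bmeas M (d N)" for N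
    unfolding d_def[abs_def] by (intro bmeas_intros bmeas_ravg T F h)
  have db: "d N x \<le> 2 * C" "d N x \<ge> 0" for N x
    using abs_ravg_le[of F C T N x, OF C(2)] hb[of x] by (auto simp: d_def)
  have bdd: "bdd_above ((\<lambda>N. d N x) ` {n..})" for n x
    using db by (intro bdd_aboveI2[where M="2*C"]) auto
  define r where "r n x = (SUP N\<in>{n..}. d N x)" for n x
  have dr: "d N x \<le> r n x" if "N \<ge> n" for N n x
    unfolding r_def using that by (intro cSUP_upper bdd) auto
  have r0: "r n x \<ge> 0" for n x
    using order_trans[OF db(2) dr[of n n x]] by simp
  have rb: "\<bar>r n x\<bar> \<le> 2 * C" for n x
    using r0[of n x] unfolding r_def by (auto intro!: cSUP_least db)
  have r: "bmeas M (r n)" for n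
  proof (rule bmeasI[OF _ rb])
    show "r n \<in> borel_measurable M"
      unfolding r_def[abs_def] using d bdd by (intro borel_measurable_cSUP) (auto intro: bmeas_measurable)
  qed
  have "(\<lambda>n. \<integral>x. r n x \<partial>M) \<longlonglongrightarrow> (\<integral>x. 0 \<partial>M)"
  proof (rule tendsto_integral_bounded[OF r bmeas_const rb])
    show "AE x in M. (\<lambda>n. r n x) \<longlonglongrightarrow> 0"
      using AE_erg[OF T F]
    proof eventually_elim
      case (elim x)
      show ?case
      proof (rule LIMSEQ_I)
        fix e :: real assume e: "e > 0"
        have "(\<lambda>N. d N x) \<longlonglongrightarrow> 0"
          using elim unfolding d_def h_def by (intro tendsto_rabs_zero) (simp add: LIM_zero)
        then have "eventually (\<lambda>N. d N x < e / 2) sequentially"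
          using e by (intro order_tendstoD(2)) auto
        then obtain n0 where n0: "\<And>N. N \<ge> n0 \<Longrightarrow> d N x < e / 2"
          unfolding eventually_sequentially by blast
        have "r n x \<le> e / 2" if "n \<ge> n0" for n
          unfolding r_def
        proof (rule cSUP_least)
          fix N assume "N \<in> {n..}"
          then show "d N x \<le> e / 2" using n0[of N] that by simp
        qed simp
        then have "norm (r n x - 0) < e" if "n \<ge> n0" for n
          using e r0[of n x] that by fastforce
        then show "\<exists>n0. \<forall>n\<ge>n0. norm (r n x - 0) < e" by blast
      qed
    qed
  qed
  then have rint: "(\<lambda>n. \<integral>x. r n x \<partial>M) \<longlonglongrightarrow> 0" by simp
  define q where "q n = erg S (r n)" for n
  have q: "bmeas M (q n)" "q n x \<ge> 0" "\<bar>q n x\<bar> \<le> 2 * C" for n x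
    unfolding q_def by (intro bmeas_erg S r erg_nonneg r0 abs_erg_le rb)+
  have bddq: "bdd_below (range (\<lambda>n. q n x))" for x
    using q(2) by (intro bdd_belowI2[where m=0]) auto
  define u where "u x = (INF n. q n x)" for x
  have u0: "u x \<ge> 0" and uq: "u x \<le> q n x" for n x
    unfolding u_def by (auto intro!: cINF_greatest q(2) cINF_lower bddq)
  have u: "bmeas M u"
  proof (rule bmeasI)
    show "u \<in> borel_measurable M"
      unfolding u_def[abs_def] using q(1) bddq by (intro borel_measurable_cINF) (auto intro: bmeas_measurable)
    show "\<bar>u x\<bar> \<le> 2 * C" for x using u0[of x] uq[of x 0] q(3)[of 0 x] by linarith
  qed
  have "integral\<^sup>L M u \<le> integral\<^sup>L M (r n)" for n
    using integral_mono[OF bmeas_integrable[OF u] bmeas_integrable[OF q(1)] uq, of n]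
    by (simp add: q_def integral_erg[OF S r])
  then have "integral\<^sup>L M u \<le> 0"
    by (intro LIMSEQ_le_const[OF rint]) auto
  moreover have "integral\<^sup>L M u \<ge> 0" by (intro integral_nonneg_AE AE_I2 u0)
  ultimately have "AE x in M. u x = 0"
    using integral_nonneg_eq_0_iff_AE[OF bmeas_integrable[OF u]] u0 by auto
  moreover have "AE x in M. \<forall>n. (\<lambda>N. ravg S (r n) N x) \<longlonglongrightarrow> q n x"
    unfolding q_def AE_all_countable using AE_erg[OF S r] by blast
  moreover have "AE x in M. (\<lambda>N. ravg S h N x) \<longlonglongrightarrow> erg S h x"
    by (rule AE_erg[OF S h])
  moreover have "AE x in M. erg S h x = integral\<^sup>L M F"
    unfolding hF
  proof (rule ergodic2_const[OF S T erg bmeas_erg[OF S h] erg_invariant[OF h]])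
    show "erg S h (T x) = erg S h x" for x
      using erg_commute[of T S h x] comm erg_invariant[OF F, of T] by (simp add: h_def)
  qed
  ultimately show ?thesis
  proof eventually_elim
    case (elim x)
    have "(\<lambda>N. ravg S (ravg T F N) N x - ravg S h N x) \<longlonglongrightarrow> 0"
    proof (rule LIMSEQ_I)
      fix e :: real assume e: "e > 0"
      then have "(INF n. q n x) < e" using elim(1) by (simp add: u_def)
      then obtain n where n: "q n x < e" using cINF_less_iff[OF _ bddq] by auto
      then have "eventually (\<lambda>N. ravg S (r n) N x < e) sequentially"
        using elim(2) order_tendstoD(2) by blast
      then have "eventually (\<lambda>N. norm (ravg S (ravg T F N) N x - ravg S h N x - 0) < e) sequentially"
        using eventually_ge_at_top[of n]
      proof eventually_elim
        case (elim N)
        have "norm (ravg S (ravg T F N) N x - ravg S h N x - 0) = \<bar>ravg S (\<lambda>x. ravg T F N x - h x) N x\<bar>"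
          by (simp add: ravg_diff)
        also have "\<dots> \<le> ravg S (d N) N x"
          unfolding ravg_def d_def by (simp add: divide_right_mono sum_abs)
        also have "\<dots> \<le> ravg S (r n) N x"
          by (intro ravg_mono dr elim)
        finally show ?case using elim by simp
      qed
      then show "\<exists>n0. \<forall>N\<ge>n0. norm (ravg S (ravg T F N) N x - ravg S h N x - 0) < e"
        by (simp add: eventually_sequentially)
    qed
    from tendsto_add[OF this elim(3)] show ?case using elim(4) by simp
  qed
qed

section \<open>Disintegration over the invariant sets\<close>

text \<open>The bits are the base 4 digits of the sum. After scaling, the later digits contribute at
  most 1/3, so the floor cuts exactly after digit i, and its parity is that digit because the base
  is even. In base 2 a tail of ones could carry over.\<close>

lemma digit_of_suminf:
  fixes b :: "nat \<Rightarrow> bool"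
  defines "f \<equiv> \<lambda>i. of_bool (b i) * (1/4) ^ Suc i :: real"
  shows "summable f" "odd \<lfloor>4 ^ Suc i * suminf f\<rfloor> \<longleftrightarrow> b i" "0 \<le> suminf f" "suminf f < 1"
proof -
  have geo: "(\<lambda>j. (1/4::real) ^ Suc j) sums (1/3)"
    using sums_mult[OF geometric_sums, of "1/4" "1/4::real"] by simp
  have le: "(of_bool (c j) :: real) * (1/4) ^ Suc j \<le> (1/4) ^ Suc j" for c :: "nat \<Rightarrow> bool" and j
    by (cases "c j") auto
  have summ: "summable (\<lambda>j. of_bool (c j) * (1/4::real) ^ Suc j)" for c :: "nat \<Rightarrow> bool"
    by (rule summable_comparison_test'[OF sums_summable[OF geo], of 0]) (use le in \<open>auto simp del: power_Suc\<close>)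
  have bound: "0 \<le> (\<Sum>j. of_bool (c j) * (1/4::real) ^ Suc j)" 
      "(\<Sum>j. of_bool (c j) * (1/4::real) ^ Suc j) \<le> 1/3" for c :: "nat \<Rightarrow> bool"
  proof -
    show "0 \<le> (\<Sum>j. of_bool (c j) * (1/4::real) ^ Suc j)" by (intro suminf_nonneg summ) auto
    show "(\<Sum>j. of_bool (c j) * (1/4::real) ^ Suc j) \<le> 1/3"
      using suminf_le[OF le[of c] summ sums_summable[OF geo]] geo by (simp add: sums_iff)
  qed
  show "summable f" unfolding f_def by (rule summ)
  show "0 \<le> suminf f" "suminf f < 1" unfolding f_def using bound[of b] by auto
  define m :: int where "m = (\<Sum>j<Suc i. of_bool (b j) * 4 ^ (i - j))"
  define t where "t = (\<Sum>j. of_bool (b (j + Suc i)) * (1/4::real) ^ Suc j)"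
  have "suminf f = (\<Sum>j. f (j + Suc i)) + (\<Sum>j<Suc i. f j)"
    by (rule suminf_split_initial_segment) fact
  moreover have "4 ^ Suc i * (\<Sum>j<Suc i. f j) = of_int m"
  proof -
    have "4 ^ Suc i * f j = of_bool (b j) * 4 ^ (i - j)" if "j < Suc i" for j
    proof -
      have "(4::real) ^ Suc i = 4 ^ (i - j) * 4 ^ Suc j"
        using that by (subst power_add[symmetric]) simp
      then show ?thesis by (simp add: f_def power_one_over del: power_Suc)
    qed
    then show ?thesis by (simp add: m_def sum_distrib_left del: power_Suc sum.lessThan_Suc)
  qed
  moreover have "4 ^ Suc i * (\<Sum>j. f (j + Suc i)) = t"
  proof -
    have "4 ^ Suc i * f (j + Suc i) = of_bool (b (j + Suc i)) * (1/4::real) ^ Suc j" for j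
      by (simp add: f_def power_add power_one_over)
    moreover have "summable (\<lambda>j. f (j + Suc i))" using \<open>summable f\<close> by (rule summable_ignore_initial_segment)
    ultimately show ?thesis unfolding t_def by (subst suminf_mult[symmetric]) (auto simp del: power_Suc)
  qed
  ultimately have "4 ^ Suc i * suminf f = of_int m + t"
    by (simp add: distrib_left del: power_Suc sum.lessThan_Suc)
  moreover have "0 \<le> t" "t < 1" unfolding t_def using bound[of "\<lambda>j. b (j + Suc i)"] by auto
  ultimately have "\<lfloor>4 ^ Suc i * suminf f\<rfloor> = m" by (simp add: floor_eq_iff)
  moreover have "odd m \<longleftrightarrow> b i"
  proof -
    have "even (\<Sum>j<i. of_bool (b j) * 4 ^ (i - j) :: int)" by (intro dvd_sum) auto
    then show ?thesis by (auto simp: m_def)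
  qed
  ultimately show "odd \<lfloor>4 ^ Suc i * suminf f\<rfloor> \<longleftrightarrow> b i" by simp
qed

text \<open>A point is coded by bits telling which balls of radius (1/2)^k about the points of a
  countable dense set contain it. For each k the first such centre is read back from the digits, and
  these centres converge to the point. The map \<open>\<psi>\<close> serves to carry conditional
  laws from the real line back to the space.\<close>

lemma polish_real_embedding:
  obtains \<phi> :: "'a::polish_space \<Rightarrow> real" and \<psi> :: "real \<Rightarrow> 'a"
  where "\<phi> \<in> borel_measurable borel" "\<psi> \<in> borel_measurable borel"
    "\<And>x. \<psi> (\<phi> x) = x" "\<And>x. 0 \<le> \<phi> x" "\<And>x. \<phi> x < 1"
proof -
  obtain D :: "'a set" where D: "countable D" "\<And>X. open X \<Longrightarrow> X \<noteq> {} \<Longrightarrow> \<exists>d\<in>D. d \<in> X"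
    by (rule countable_dense_setE) blast
  have "D \<noteq> {}" using D(2)[of UNIV] by auto
  define d where "d = from_nat_into D"
  have d: "\<exists>n. dist x (d n) < (1/2) ^ k" for x and k :: nat
  proof -
    obtain z where "z \<in> D" "z \<in> ball x ((1/2) ^ k)" using D(2)[of "ball x ((1/2) ^ k)"]
      by (metis centre_in_ball empty_iff half_gt_zero_iff open_ball zero_less_one zero_less_power)
    moreover then obtain n where "z = d n"
      using D(1) from_nat_into_surj[of D z] unfolding d_def by metis
    ultimately show ?thesis by auto
  qed
  define b where "b x i \<longleftrightarrow> dist x (d (snd (prod_decode i))) < (1/2) ^ fst (prod_decode i)" for x i
  define \<phi> where "\<phi> x = (\<Sum>i. of_bool (b x i) * (1/4) ^ Suc i :: real)" for x
  define n where "n k r = (LEAST n. odd \<lfloor>4 ^ Suc (prod_encode (k, n)) * (r::real)\<rfloor>)" for k r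
  \<comment> \<open>The default \<open>d 0\<close> keeps \<open>\<psi>\<close> total and measurable
    off the range of \<open>\<phi>\<close>.\<close>
  define \<psi> where "\<psi> r = (if Cauchy (\<lambda>k. d (n k r)) then lim (\<lambda>k. d (n k r)) else d 0)" for r
  have [measurable]: "d \<in> measurable (count_space UNIV) borel" by simp
  have [measurable]: "n k \<in> measurable borel (count_space UNIV)" for k
    unfolding n_def[abs_def] by measurable
  have "\<phi> \<in> borel_measurable borel"
    unfolding \<phi>_def[abs_def] b_def by measurable
  moreover have "\<psi> \<in> borel_measurable borel"
  proof (rule borel_measurable_LIMSEQ_metric)
    show "(\<lambda>r. if Cauchy (\<lambda>k. d (n k r)) then d (n i r) else d 0) \<in> borel_measurable borel" for i
      by measurable
    show "(\<lambda>i. if Cauchy (\<lambda>k. d (n k r)) then d (n i r) else d 0) \<longlonglongrightarrow> \<psi> r" for r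
      unfolding \<psi>_def by (auto simp: Cauchy_convergent_iff convergent_LIMSEQ_iff)
  qed
  moreover have "\<psi> (\<phi> x) = x" for x
  proof -
    have "n k (\<phi> x) = (LEAST n. dist x (d n) < (1/2) ^ k)" for k
      unfolding n_def \<phi>_def digit_of_suminf(2) by (simp add: b_def)
    then have *: "dist x (d (n k (\<phi> x))) < (1/2) ^ k" for k
      using LeastI_ex[OF d] by simp
    have "(\<lambda>k. d (n k (\<phi> x))) \<longlonglongrightarrow> x"
    proof (rule metric_LIMSEQ_I)
      fix e :: real assume "e > 0"
      then obtain k0 where k0: "(1/2) ^ k0 < e" using real_arch_pow_inv[of e "1/2"] by auto
      have "dist (d (n k (\<phi> x))) x < e" if "k \<ge> k0" for k
      proof -
        have "(1/2::real) ^ k \<le> (1/2) ^ k0" using that by (intro power_decreasing) auto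
        then show ?thesis using *[of k] k0 unfolding dist_commute[of _ x] by linarith
      qed
      then show "\<exists>k0. \<forall>k\<ge>k0. dist (d (n k (\<phi> x))) x < e" by blast
    qed
    then show ?thesis
      unfolding \<psi>_def using LIMSEQ_imp_Cauchy limI by auto
  qed
  moreover have "0 \<le> \<phi> x" "\<phi> x < 1" for x unfolding \<phi>_def by (rule digit_of_suminf)+
  ultimately show ?thesis using that by blast
qed

section \<open>Conditional laws as images of the uniform measure\<close>

definition unif :: "real measure" where "unif = uniform_measure lborel {0<..1}"

lemma sets_unif[simp, measurable_cong]: "sets unif = sets borel"
  and space_unif[simp]: "space unif = UNIV"
  by (simp_all add: unif_def)

lemma prob_space_unif: "prob_space unif"
  unfolding unif_def by (rule prob_space_uniform_measure) auto

lemma AE_unif: "AE t in unif. 0 < t \<and> t \<le> 1"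
  unfolding unif_def by (rule AE_uniform_measureI) auto

lemma measure_unif: "0 \<le> c \<Longrightarrow> c \<le> 1 \<Longrightarrow> measure unif {..c} = c"
proof -
  assume c: "0 \<le> c" "c \<le> 1"
  then have "{0<..1} \<inter> {..c} = {0<..c}" by auto
  then show ?thesis using c by (simp add: unif_def)
qed

text \<open>Test with a = u - v.\<close>

lemma (in prob_space) eq_of_integral_mult_eq:
  assumes u: "bmeas M u" and v: "bmeas M v"
    and eq: "\<And>a. bmeas M a \<Longrightarrow> (\<integral>x. a x * u x \<partial>M) = (\<integral>x. a x * v x \<partial>M)"
  shows "AE x in M. u x = v x"
proof -
  have d: "bmeas M (\<lambda>x. u x - v x)" by (intro bmeas_diff u v)
  have "(\<integral>x. (u x - v x)\<^sup>2 \<partial>M) = (\<integral>x. (u x - v x) * u x - (u x - v x) * v x \<partial>M)"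
    by (simp add: power2_eq_square algebra_simps)
  also have "\<dots> = 0"
    using eq[OF d] by (subst Bochner_Integration.integral_diff) (auto intro!: bmeas_integrable bmeas_mult d u v)
  finally have "AE x in M. (u x - v x)\<^sup>2 = 0"
    using integral_nonneg_eq_0_iff_AE[OF bmeas_integrable[OF bmeas_power2[OF d]]] by simp
  then show ?thesis by simp
qed

text \<open>The order may break where one of the averages diverges, since the limit is then replaced
  by the default 0.\<close>

lemma (in prob_space) erg_mono_AE:
  assumes "mp_map M R" "bmeas M f" "bmeas M g" "\<And>x. f x \<le> g x"
  shows "AE x in M. erg R f x \<le> erg R g x"
  using AE_erg[OF assms(1,2)] AE_erg[OF assms(1,3)]
proof eventually_elim
  case (elim x)
  show ?case by (rule LIMSEQ_le[OF elim]) (auto intro!: ravg_mono assms(4))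
qed

lemma erg_const: "erg R (\<lambda>x. c) x = c"
  by (rule erg_eqI, rule tendsto_eventually) 
     (auto simp: eventually_sequentially ravg_const intro!: exI[of _ 1])

lemma bmeas_ind: "{x \<in> space M. P x} \<in> sets M \<Longrightarrow> bmeas M (\<lambda>x. of_bool (P x))"
  by (rule bmeasI[where C=1]) (auto simp: of_bool_def)

text \<open>If \<open>g\<close> is not integrable its integral is 0, so the bound also covers
  non-measurable sections, as may occur at points outside \<open>space M\<close>.\<close>

lemma abs_integral_unif_le:
  fixes g :: "real \<Rightarrow> real"
  assumes "\<And>t. \<bar>g t\<bar> \<le> C"
  shows "\<bar>\<integral>t. g t \<partial>unif\<bar> \<le> C"
proof -
  interpret U: prob_space unif by (rule prob_space_unif)
  show ?thesis
  proof (cases "integrable unif g")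
    case True
    have "\<bar>\<integral>t. g t \<partial>unif\<bar> \<le> (\<integral>t. \<bar>g t\<bar> \<partial>unif)" by (rule integral_abs_bound)
    also have "\<dots> \<le> (\<integral>t. C \<partial>unif)"
      using True assms by (intro integral_mono) auto
    also have "\<dots> = C" using U.prob_space by simp
    finally show ?thesis .
  next
    case False
    then show ?thesis using order_trans[OF abs_ge_zero assms] by (simp add: not_integrable_integral_eq)
  qed
qed

lemma bmeas_integral_unif:
  assumes "bmeas (M \<Otimes>\<^sub>M unif) (\<lambda>(x, t). g x t)"
  shows "bmeas M (\<lambda>x. \<integral>t. g x t \<partial>unif)"
proof -
  interpret U: prob_space unif by (rule prob_space_unif)
  obtain C where C: "\<And>w. \<bar>(\<lambda>(x, t). g x t) w\<bar> \<le> C" using assms by (metis bmeas_bound)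
  show ?thesis
  proof (rule bmeasI)
    show "(\<lambda>x. \<integral>t. g x t \<partial>unif) \<in> borel_measurable M"
      by (rule U.borel_measurable_lebesgue_integral) (rule bmeas_measurable[OF assms])
    show "\<bar>\<integral>t. g x t \<partial>unif\<bar> \<le> C" for x
      using C[of "(x, _)"] by (intro abs_integral_unif_le) simp
  qed
qed

text \<open>\<open>Y x\<close> is the decreasing quantile function of the conditional law of \<open>\<phi>\<close> given the
  \<open>S\<close>-invariant sets: it carries the uniform distribution on \<open>(0,1]\<close> to that law.\<close>

lemma (in prob_space) real_conditional_kernel:
  assumes S: "mp_map M S" and \<phi>[measurable]: "\<phi> \<in> borel_measurable M"
    and \<phi>01: "\<And>x. 0 \<le> \<phi> x" "\<And>x. \<phi> x < 1"
  obtains Y :: "'a \<Rightarrow> real \<Rightarrow> real" where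
    "(\<lambda>(x, t). Y x t) \<in> borel_measurable (M \<Otimes>\<^sub>M unif)"
    "\<And>x t. Y (S x) t = Y x t"
    "\<And>a s. bmeas M a \<Longrightarrow> 
       (\<integral>x. a x * (\<integral>t. of_bool (s < Y x t) \<partial>unif) \<partial>M) = (\<integral>x. erg S a x * of_bool (s < \<phi> x) \<partial>M)"
proof -
  interpret U: prob_space unif by (rule prob_space_unif)
  define I where "I s x = (of_bool (s < \<phi> x) :: real)" for s x
  have I[simp, intro]: "bmeas M (I s)" for s unfolding I_def[abs_def] by (intro bmeas_ind) measurable
  \<comment> \<open>\<open>F q\<close> is a version of the conditional probability that
    \<open>\<phi>\<close> exceeds q. Rational q leave only countably many exceptional sets.\<close>
  define F where "F q = erg S (I (of_rat q))" for q :: rat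
  have F: "bmeas M (F q)" for q unfolding F_def by (intro bmeas_erg S I)
  note [measurable] = bmeas_measurable[OF F]
  have F01: "0 \<le> F q x" "F q x \<le> 1" for q x
  proof -
    have "\<bar>F q x\<bar> \<le> 1" unfolding F_def by (rule abs_erg_le) (simp add: I_def)
    then show "F q x \<le> 1" by simp
    show "0 \<le> F q x" unfolding F_def by (rule erg_nonneg) (simp add: I_def)
  qed
  \<comment> \<open>Below 0 and from 1 on the value of \<open>F\<close> is known at every x, which
    makes \<open>A x t\<close> nonempty and bounded above for all x and 0 < t \<le> 1.\<close>
  have F_big: "F q x = 0" if "q \<ge> 1" for q x
  proof -
    have "real_of_rat q \<ge> 1" using that by (metis of_rat_1 of_rat_less_eq)
    then have "\<not> of_rat q < \<phi> x" for x using \<phi>01(2)[of x] by linarith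
    then have "I (of_rat q) = (\<lambda>x. 0)" by (simp add: I_def fun_eq_iff)
    then show ?thesis by (simp add: F_def erg_const)
  qed
  have F_small: "F q x = 1" if "q < 0" for q x
  proof -
    have "real_of_rat q < 0" using that by simp
    then have "of_rat q < \<phi> x" for x using \<phi>01(1)[of x] by linarith
    then have "I (of_rat q) = (\<lambda>x. 1)" by (simp add: I_def fun_eq_iff)
    then show ?thesis by (simp add: F_def erg_const)
  qed
  define A where "A x t = {q. t \<le> F q x}" for x and t :: real
  \<comment> \<open>Parameters outside (0,1] form a null set for \<open>unif\<close>; the value 0
    there is a default.\<close>
  define Y where "Y x t = (if 0 < t \<and> t \<le> 1 then SUP q\<in>A x t. real_of_rat q else 0)" for x t
  have bdd: "bdd_above (real_of_rat ` A x t)" if "0 < t" for x t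
  proof (rule bdd_aboveI2)
    fix q assume "q \<in> A x t"
    then have "\<not> q \<ge> 1" using F_big[of q x] that by (auto simp: A_def)
    then show "real_of_rat q \<le> 1" by (metis linear of_rat_1 of_rat_less_eq)
  qed
  have ne: "A x t \<noteq> {}" if "t \<le> 1" for x t
    using F_small[of "-1" x] that by (auto simp: A_def intro!: exI[of _ "-1"])
  have Y_less: "s < Y x t \<longleftrightarrow> (\<exists>q. s < of_rat q \<and> t \<le> F q x)" if "0 < t" "t \<le> 1" for s x t
    using that less_cSUP_iff[OF ne[OF that(2)] bdd[OF that(1)], of s x] by (auto simp: Y_def A_def)
  have meas: "(\<lambda>(x, t). Y x t) \<in> borel_measurable (M \<Otimes>\<^sub>M unif)"
    unfolding borel_measurable_iff_greater
  proof
    fix s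
    have "{w \<in> space (M \<Otimes>\<^sub>M unif). s < (case w of (x, t) \<Rightarrow> Y x t)} = 
      {w \<in> space (M \<Otimes>\<^sub>M unif). if 0 < snd w \<and> snd w \<le> 1 then \<exists>q. s < of_rat q \<and> snd w \<le> F q (fst w) else s < 0}"
    proof (rule Collect_cong, rule conj_cong[OF refl])
      fix w :: "'a \<times> real"
      obtain x t where w: "w = (x, t)" by (cases w)
      have "Y x t = 0" if "\<not> (0 < t \<and> t \<le> 1)" using that by (auto simp: Y_def)
      then show "s < (case w of (x, t) \<Rightarrow> Y x t) \<longleftrightarrow>
          (if 0 < snd w \<and> snd w \<le> 1 then \<exists>q. s < of_rat q \<and> snd w \<le> F q (fst w) else s < 0)"
        using Y_less[of t s x] by (cases "0 < t \<and> t \<le> 1") (simp add: w, simp only: w split_conv fst_conv snd_conv if_False simp_thms)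
    qed
    also have "\<dots> \<in> sets (M \<Otimes>\<^sub>M unif)"
      by measurable
    finally show "{w \<in> space (M \<Otimes>\<^sub>M unif). s < (case w of (x, t) \<Rightarrow> Y x t)} \<in> sets (M \<Otimes>\<^sub>M unif)" .
  qed
  have [measurable]: "Y x \<in> borel_measurable unif" if "x \<in> space M" for x
    using measurable_Pair2[OF meas that] by simp
  \<comment> \<open>\<open>Y\<close> sees x only through values of \<open>erg S\<close>, which are
    invariant at every point.\<close>
  have inv: "Y (S x) t = Y x t" for x t
    using erg_invariant[OF I, of S] by (simp add: Y_def A_def F_def)
  have mono: "AE x in M. \<forall>q r. q \<le> r \<longrightarrow> F r x \<le> F q x"
  proof -
    have "AE x in M. q \<le> r \<longrightarrow> F r x \<le> F q x" for q r
    proof (cases "q \<le> r")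
      case True
      then have "real_of_rat q \<le> of_rat r" by (simp add: of_rat_less_eq)
      then have "I (of_rat r) x \<le> I (of_rat q) x" for x by (auto simp: I_def)
      then show ?thesis unfolding F_def by (auto intro: erg_mono_AE S)
    qed auto
    then show ?thesis by (simp add: AE_all_countable)
  qed
  have law: "(\<integral>x. a x * (\<integral>t. of_bool (s < Y x t) \<partial>unif) \<partial>M) = (\<integral>x. erg S a x * of_bool (s < \<phi> x) \<partial>M)"
    if a: "bmeas M a" for a s
  proof -
    \<comment> \<open>The thresholds \<open>q n\<close> approach s strictly from above, which
      matches the strict inequalities \<open>s < Y x t\<close> and
      \<open>s < \<phi> x\<close>.\<close>
    have "\<exists>q. s < of_rat q \<and> of_rat q < s + 1 / real (Suc n)" for n
      using of_rat_dense[of s "s + 1 / real (Suc n)"] by auto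
    then obtain q where q: "\<And>n. s < of_rat (q n)" "\<And>n. of_rat (q n) < s + 1 / real (Suc n)" by metis
    have q_lim: "(\<lambda>n. real_of_rat (q n)) \<longlonglongrightarrow> s"
    proof (rule tendsto_sandwich[of "\<lambda>n. s" _ _ "\<lambda>n. s + 1 / real (Suc n)"])
      show "(\<lambda>n. s + 1 / real (Suc n)) \<longlonglongrightarrow> s"
        using tendsto_add[OF tendsto_const LIMSEQ_Suc[OF lim_1_over_n], of s] by simp
    qed (use q in \<open>auto intro!: always_eventually less_imp_le simp del: of_nat_Suc\<close>)
    have below: "eventually (\<lambda>n. real_of_rat (q n) < r) sequentially" if "s < r" for r
      using order_tendstoD(2)[OF q_lim that] .
    have fib: "(\<integral>t. of_bool (t \<le> F r x) \<partial>unif) = F r x" for r x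
    proof -
      have "(\<integral>t. of_bool (t \<le> F r x) \<partial>unif) = (\<integral>t. indicator {..F r x} t \<partial>unif :: real)"
        by (intro Bochner_Integration.integral_cong) (auto simp: of_bool_def indicator_def)
      then show ?thesis using measure_unif[OF F01] by simp
    qed
    \<comment> \<open>Where \<open>F\<close> is antitone in q, a single rational r > s with t \<le>
      F r x forces t \<le> F (q n) x for all large n. So the indicators converge to that of s < Y x
      t, and by \<open>fib\<close> their integrals over t are \<open>F (q n) x\<close>.\<close>
    have lim: "AE x in M. (\<lambda>n. F (q n) x) \<longlonglongrightarrow> (\<integral>t. of_bool (s < Y x t) \<partial>unif)"
      using mono AE_space
    proof eventually_elim
      case (elim x)
      have "(\<lambda>n. \<integral>t. of_bool (t \<le> F (q n) x) \<partial>unif) \<longlonglongrightarrow> (\<integral>t. of_bool (s < Y x t) \<partial>unif :: real)"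
      proof (rule U.tendsto_integral_bounded)
        show "bmeas unif (\<lambda>t. of_bool (t \<le> F (q n) x))" for n by (intro bmeas_ind) measurable
        show "bmeas unif (\<lambda>t. of_bool (s < Y x t))" using elim(2) by (intro bmeas_ind) measurable
        show "\<bar>of_bool (t \<le> F (q n) x) :: real\<bar> \<le> 1" for n t by simp
        show "AE t in unif. (\<lambda>n. of_bool (t \<le> F (q n) x) :: real) \<longlonglongrightarrow> of_bool (s < Y x t)"
          using AE_unif
        proof eventually_elim
          case t: (elim t)
          show ?case
          proof (cases "s < Y x t")
            case True
            then obtain r where r: "s < of_rat r" "t \<le> F r x" using Y_less t by auto
            from below[OF r(1)] have "eventually (\<lambda>n. t \<le> F (q n) x) sequentially"
            proof eventually_elim
              case (elim n)
              then have "q n \<le> r" by (simp add: of_rat_less)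
              then show ?case using \<open>\<forall>q r. q \<le> r \<longrightarrow> F r x \<le> F q x\<close> r(2) by (meson order_trans)
            qed
            then show ?thesis using True by (intro tendsto_eventually) (auto elim: eventually_mono)
          next
            case False
            then have "\<not> t \<le> F (q n) x" for n using q(1) Y_less t by blast
            then show ?thesis using False by simp
          qed
        qed
      qed
      then show ?case by (simp add: fib)
    qed
    obtain C where C: "C \<ge> 0" "\<And>x. \<bar>a x\<bar> \<le> C" using a by (metis bmeas_bound)
    have kb: "bmeas M (\<lambda>x. \<integral>t. of_bool (s < Y x t) \<partial>unif)"
    proof (rule bmeas_integral_unif)
      have [measurable]: "(\<lambda>w. Y (fst w) (snd w)) \<in> borel_measurable (M \<Otimes>\<^sub>M unif)"
        using meas by (simp add: case_prod_beta')
      show "bmeas (M \<Otimes>\<^sub>M unif) (\<lambda>(x, t). of_bool (s < Y x t))"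
        unfolding case_prod_beta' by (intro bmeas_ind) measurable
    qed
    have "(\<lambda>n. \<integral>x. a x * F (q n) x \<partial>M) \<longlonglongrightarrow> (\<integral>x. a x * (\<integral>t. of_bool (s < Y x t) \<partial>unif) \<partial>M)"
    proof (rule tendsto_integral_bounded)
      show "\<bar>a x * F (q n) x\<bar> \<le> C * 1" for n x
        unfolding abs_mult using F01[of "q n" x] by (intro mult_mono C) auto
      show "AE x in M. (\<lambda>n. a x * F (q n) x) \<longlonglongrightarrow> a x * (\<integral>t. of_bool (s < Y x t) \<partial>unif)"
        using lim by (auto intro: tendsto_mult_left)
    qed (intro bmeas_mult a F kb)+
    moreover have "(\<lambda>n. \<integral>x. a x * F (q n) x \<partial>M) \<longlonglongrightarrow> (\<integral>x. erg S a x * I s x \<partial>M)"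
    proof -
      have "(\<lambda>n. \<integral>x. erg S a x * I (of_rat (q n)) x \<partial>M) \<longlonglongrightarrow> (\<integral>x. erg S a x * I s x \<partial>M)"
      proof (rule tendsto_integral_bounded)
        show "\<bar>erg S a x * I (of_rat (q n)) x\<bar> \<le> C * 1" for n x
          unfolding abs_mult by (intro mult_mono abs_erg_le C) (auto simp: I_def)
        have "(\<lambda>n. I (of_rat (q n)) x) \<longlonglongrightarrow> I s x" for x
        proof (cases "s < \<phi> x")
          case True
          then show ?thesis using below[OF True]
            by (intro tendsto_eventually) (auto simp: I_def elim: eventually_mono)
        next
          case False
          then have "\<not> of_rat (q n) < \<phi> x" for n using q(1)[of n] by auto
          then show ?thesis using False by (simp add: I_def)
        qed
        then show "AE x in M. (\<lambda>n. erg S a x * I (of_rat (q n)) x) \<longlonglongrightarrow> erg S a x * I s x"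
          by (intro AE_I2 tendsto_mult_left)
      qed (intro bmeas_mult bmeas_erg a S I)+
      then show ?thesis unfolding F_def by (simp add: integral_erg_swap[OF S a I])
    qed
    ultimately show ?thesis using LIMSEQ_unique unfolding I_def by blast
  qed
  show ?thesis by (rule that[OF meas inv law])
qed

section \<open>The relatively independent self-joining\<close>

lemma (in finite_measure) finite_measure_density:
  assumes a: "bmeas M a" "\<And>x. 0 \<le> a x"
  shows "finite_measure (density M a)"
proof (rule finite_measureI)
  note [measurable] = bmeas_measurable[OF a(1)]
  have "emeasure (density M a) (space M) = (\<integral>\<^sup>+x. ennreal (a x) \<partial>M)"
    by (subst emeasure_density) (auto intro!: nn_integral_cong)
  also have "\<dots> = ennreal (\<integral>x. a x \<partial>M)"
    by (intro nn_integral_eq_integral bmeas_integrable a) (auto simp: a)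
  finally show "emeasure (density M a) (space (density M a)) \<noteq> \<infinity>" by simp
qed

text \<open>As a is nonnegative, both sides are integrals of c against finite measures on the real
  line, images of measures with densities a and \<open>erg S a\<close>. By \<open>law\<close> these
  agree on all rays, hence are equal.\<close>

lemma (in prob_space) conditional_kernel_nonneg:
  fixes Y :: "'a \<Rightarrow> real \<Rightarrow> real"
  assumes S: "mp_map M S" and \<phi>[measurable]: "\<phi> \<in> borel_measurable M"
    and Y: "(\<lambda>(x, t). Y x t) \<in> borel_measurable (M \<Otimes>\<^sub>M unif)"
    and law: "\<And>a s. bmeas M a \<Longrightarrow> 
       (\<integral>x. a x * (\<integral>t. of_bool (s < Y x t) \<partial>unif) \<partial>M) = (\<integral>x. erg S a x * of_bool (s < \<phi> x) \<partial>M)"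
    and a: "bmeas M a" "\<And>x. 0 \<le> a x" and c: "bmeas borel c"
  shows "(\<integral>x. a x * (\<integral>t. c (Y x t) \<partial>unif) \<partial>M) = (\<integral>x. erg S a x * c (\<phi> x) \<partial>M)"
proof -
  interpret U: prob_space unif by (rule prob_space_unif)
  interpret P: pair_prob_space M unif ..
  define Y' where "Y' w = Y (fst w) (snd w)" for w
  have [measurable]: "Y' \<in> borel_measurable (M \<Otimes>\<^sub>M unif)"
    using Y by (simp add: case_prod_beta' Y'_def[abs_def])
  have e: "bmeas M (erg S a)" by (intro bmeas_erg S a)
  have e0: "0 \<le> erg S a x" for x by (intro erg_nonneg a)
  note [measurable] = bmeas_measurable[OF a(1)] bmeas_measurable[OF e]
  define m1 where "m1 = distr (density (M \<Otimes>\<^sub>M unif) (\<lambda>w. a (fst w))) borel Y'"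
  define m2 where "m2 = distr (density M (erg S a)) borel \<phi>"
  have i1: "(\<integral>r. b r \<partial>m1) = (\<integral>x. a x * (\<integral>t. b (Y x t) \<partial>unif) \<partial>M)" if b: "bmeas borel b" for b :: "real \<Rightarrow> real"
  proof -
    note [measurable] = bmeas_measurable[OF b]
    have ab: "bmeas (M \<Otimes>\<^sub>M unif) (\<lambda>w. a (fst w) * b (Y' w))"
      by (intro bmeas_mult bmeas_compose[OF a(1)] bmeas_compose[OF b]) measurable
    have "(\<integral>r. b r \<partial>m1) = (\<integral>w. a (fst w) * b (Y' w) \<partial>(M \<Otimes>\<^sub>M unif))"
      unfolding m1_def by (simp add: integral_distr integral_density a)
    also have "\<dots> = (\<integral>x. (\<integral>t. a x * b (Y x t) \<partial>unif) \<partial>M)"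
      using P.integral_fst'[OF P.bmeas_integrable[OF ab]] by (simp add: Y'_def)
    finally show ?thesis by simp
  qed
  have i2: "(\<integral>r. b r \<partial>m2) = (\<integral>x. erg S a x * b (\<phi> x) \<partial>M)" if b: "bmeas borel b" for b :: "real \<Rightarrow> real"
  proof -
    note [measurable] = bmeas_measurable[OF b]
    show ?thesis unfolding m2_def by (simp add: integral_distr integral_density e0)
  qed
  interpret D1: finite_measure "density (M \<Otimes>\<^sub>M unif) (\<lambda>w. a (fst w))"
    by (intro P.finite_measure_density bmeas_compose[OF a(1)] a(2)) measurable
  interpret D2: finite_measure "density M (erg S a)"
    by (intro finite_measure_density e e0)
  interpret m1: finite_measure m1
    unfolding m1_def by (rule D1.finite_measure_distr) measurable
  interpret m2: finite_measure m2
    unfolding m2_def by (rule D2.finite_measure_distr) measurable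
  have "m1 = m2"
  proof (rule measure_eqI_lessThan)
    show "emeasure m1 {s<..} < \<infinity>" for s by (simp add: m1.emeasure_eq_measure)
    show "emeasure m1 {s<..} = emeasure m2 {s<..}" for s
    proof -
      have b: "bmeas borel (\<lambda>r. of_bool (s < r))" by (intro bmeas_ind) simp
      have *: "(\<lambda>r. of_bool (s < r) :: real) = indicator {s<..}" by (auto simp: indicator_def)
      have "measure m1 {s<..} = (\<integral>r. of_bool (s < r) \<partial>m1)"
        unfolding * by (simp add: m1_def)
      also have "\<dots> = (\<integral>r. of_bool (s < r) \<partial>m2)"
        unfolding i1[OF b] i2[OF b] by (rule law[OF a(1)])
      also have "\<dots> = measure m2 {s<..}"
        unfolding * by (simp add: m2_def)
      finally show ?thesis by (simp add: m1.emeasure_eq_measure m2.emeasure_eq_measure)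
    qed
  qed (simp_all add: m1_def m2_def)
  then show ?thesis using i1[OF c] i2[OF c] by simp
qed

text \<open>\<open>\<phi>\<close> moves the problem to the real line and \<open>\<psi>\<close> moves
  the kernel back; self-adjointness of \<open>erg S\<close> gives the right side the form of a
  conditional expectation.\<close>

lemma conditional_kernel:
  fixes M :: "'a::polish_space measure"
  assumes M: "prob_space M" "sets M = sets borel" and S: "mp_map M S"
  obtains Y :: "'a \<Rightarrow> real \<Rightarrow> 'a" where
    "(\<lambda>(x, t). Y x t) \<in> measurable (M \<Otimes>\<^sub>M unif) M"
    "\<And>x t. Y (S x) t = Y x t"
    "\<And>a b. bmeas M a \<Longrightarrow> bmeas M b \<Longrightarrow>
       (\<integral>x. a x * (\<integral>t. b (Y x t) \<partial>unif) \<partial>M) = (\<integral>x. a x * erg S b x \<partial>M)"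
proof -
  interpret prob_space M by fact
  have [measurable_cong, simp]: "sets M = sets borel" by fact
  obtain \<phi> :: "'a \<Rightarrow> real" and \<psi> where emb: "\<phi> \<in> borel_measurable borel" "\<psi> \<in> borel_measurable borel"
    "\<And>x. \<psi> (\<phi> x) = x" "\<And>x. 0 \<le> \<phi> x" "\<And>x. \<phi> x < 1"
    by (rule polish_real_embedding) blast
  note [measurable] = emb(1,2)
  have \<phi>: "\<phi> \<in> borel_measurable M" by measurable
  obtain Y where Y: "(\<lambda>(x, t). Y x t) \<in> borel_measurable (M \<Otimes>\<^sub>M unif)" "\<And>x t. Y (S x) t = Y x t"
    "\<And>a s. bmeas M a \<Longrightarrow> 
       (\<integral>x. a x * (\<integral>t. of_bool (s < Y x t) \<partial>unif) \<partial>M) = (\<integral>x. erg S a x * of_bool (s < \<phi> x) \<partial>M)"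
    using real_conditional_kernel[OF S \<phi> emb(4,5)] by blast
  have [measurable]: "(\<lambda>w. Y (fst w) (snd w)) \<in> borel_measurable (M \<Otimes>\<^sub>M unif)"
    using Y(1) by (simp add: case_prod_beta')
  show ?thesis
  proof (rule that[of "\<lambda>x t. \<psi> (Y x t)"])
    show "(\<lambda>(x, t). \<psi> (Y x t)) \<in> measurable (M \<Otimes>\<^sub>M unif) M"
      by measurable
    show "\<psi> (Y (S x) t) = \<psi> (Y x t)" for x t by (simp add: Y)
    fix a b assume a: "bmeas M a" and b: "bmeas M b"
    have c: "bmeas borel (\<lambda>r. b (\<psi> r))"
      using b by (rule bmeas_compose) measurable
    define k where "k x = (\<integral>t. b (\<psi> (Y x t)) \<partial>unif)" for x
    have k: "bmeas M k" unfolding k_def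
      by (intro bmeas_integral_unif, unfold case_prod_beta', rule bmeas_compose[OF c]) measurable
    have nonneg: "(\<integral>x. a x * k x \<partial>M) = (\<integral>x. a x * erg S b x \<partial>M)" if "bmeas M a" "\<And>x. 0 \<le> a x" for a
      using conditional_kernel_nonneg[OF S \<phi> Y(1,3) that c] integral_erg_swap[OF S that(1) b]
      by (simp add: k_def emb)
    obtain C where C: "C \<ge> 0" "\<And>x. \<bar>a x\<bar> \<le> C" using a by (metis bmeas_bound)
    \<comment> \<open>A general a is the difference of the nonnegative functions a + C and
      C.\<close>
    have "(\<integral>x. (a x + C) * k x \<partial>M) = (\<integral>x. (a x + C) * erg S b x \<partial>M)"
      using C by (intro nonneg bmeas_add a bmeas_const) (smt (verit) abs_le_iff)
    moreover have "(\<integral>x. C * k x \<partial>M) = (\<integral>x. C * erg S b x \<partial>M)"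
      using C by (intro nonneg bmeas_const) auto
    moreover have "(\<integral>x. (a x + C) * h x \<partial>M) = (\<integral>x. a x * h x \<partial>M) + (\<integral>x. C * h x \<partial>M)" if "bmeas M h" for h
      unfolding distrib_right
      by (intro Bochner_Integration.integral_add bmeas_integrable bmeas_mult a that bmeas_const)
    ultimately show "(\<integral>x. a x * (\<integral>t. b (\<psi> (Y x t)) \<partial>unif) \<partial>M) = (\<integral>x. a x * erg S b x \<partial>M)"
      using k bmeas_erg[OF S b] unfolding k_def[symmetric] by auto
  qed
qed

text \<open>The map \<open>Y x\<close> carries \<open>unif\<close> to the conditional law at x given
  the S-invariant sets. Parametrising these laws by t turns integrals over the joining into
  integrals over \<open>M \<Otimes>\<^sub>M unif\<close>, where Fubini applies. The equations for S,
  T and T' hold at every point, so orbits can be rewritten freely.\<close>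

locale self_joining = prob_space M for M :: "'a measure" +
  fixes S T T' :: "'a \<Rightarrow> 'a" and Y :: "'a \<Rightarrow> real \<Rightarrow> 'a"
  assumes S: "mp_map M S" and T: "mp_map M T" and T': "mp_map M T'"
    and T_T'[simp]: "\<And>x. T (T' x) = x" and T'_T[simp]: "\<And>x. T' (T x) = x"
    and S_T: "\<And>x. S (T x) = T (S x)"
    and ergodic: "ergodic2 M S T"
    and Y: "(\<lambda>(x, t). Y x t) \<in> measurable (M \<Otimes>\<^sub>M unif) M"
    and Y_S: "\<And>x t. Y (S x) t = Y x t"
    and Y_law: "\<And>a b. bmeas M a \<Longrightarrow> bmeas M b \<Longrightarrow>
       (\<integral>x. a x * (\<integral>t. b (Y x t) \<partial>unif) \<partial>M) = (\<integral>x. a x * erg S b x \<partial>M)"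
begin

section \<open>The joining and its fibre integrals\<close>

sublocale U: prob_space unif by (rule prob_space_unif)
sublocale P: pair_prob_space M unif ..

lemma S_meas[measurable]: "S \<in> measurable M M" and T_meas[measurable]: "T \<in> measurable M M"
  and T'_meas[measurable]: "T' \<in> measurable M M"
  using S T T' by (auto simp: mp_map_def)

definition lift :: "'a \<times> real \<Rightarrow> 'a \<times> 'a" where "lift w = (fst w, Y (fst w) (snd w))"

lemma Y_meas[measurable]: "(\<lambda>w. Y (fst w) (snd w)) \<in> measurable (M \<Otimes>\<^sub>M unif) M"
  using Y by (simp add: case_prod_beta')

lemma lift_meas[measurable]: "lift \<in> measurable (M \<Otimes>\<^sub>M unif) (M \<Otimes>\<^sub>M M)"
  unfolding lift_def[abs_def] by measurable

text \<open>This is the relatively independent self-joining of M over the S-invariant sets;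
  \<open>integral_tensor\<close> is the identity that characterises it.\<close>

definition joining :: "('a \<times> 'a) measure" where
  "joining = distr (M \<Otimes>\<^sub>M unif) (M \<Otimes>\<^sub>M M) lift"

lemma sets_joining[simp, measurable_cong]: "sets joining = sets (M \<Otimes>\<^sub>M M)"
  by (simp add: joining_def)

lemma bmeas_joining: "bmeas joining F \<longleftrightarrow> bmeas (M \<Otimes>\<^sub>M M) F"
  by (simp add: bmeas_def cong: measurable_cong_sets)

sublocale J: prob_space joining
  unfolding joining_def by (rule P.prob_space_distr) measurable

text \<open>This integrates F (x, y) in y against the conditional law at x, so it disintegrates the
  joining over the first coordinate.\<close>

definition fibre :: "('a \<times> 'a \<Rightarrow> real) \<Rightarrow> 'a \<Rightarrow> real" where
  "fibre F x = (\<integral>t. F (x, Y x t) \<partial>unif)"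

lemma bmeas_lift: "bmeas joining F \<Longrightarrow> bmeas (M \<Otimes>\<^sub>M unif) (\<lambda>w. F (lift w))"
  by (rule bmeas_compose[of "M \<Otimes>\<^sub>M M"]) (simp_all add: bmeas_joining)

lemma bmeas_fibre: "bmeas joining F \<Longrightarrow> bmeas M (fibre F)"
  unfolding fibre_def[abs_def]
  using bmeas_lift[of F] by (intro bmeas_integral_unif) (simp add: case_prod_beta' lift_def)

lemma bmeas_section:
  assumes "bmeas joining F" "x \<in> space M"
  shows "bmeas unif (\<lambda>t. F (x, Y x t))"
  using bmeas_compose[OF bmeas_lift[OF assms(1)] measurable_Pair1'[OF assms(2)]] by (simp add: lift_def)

lemma integral_joining:
  assumes "bmeas joining F"
  shows "integral\<^sup>L joining F = (\<integral>x. fibre F x \<partial>M)"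
proof -
  have "integral\<^sup>L joining F = (\<integral>w. F (lift w) \<partial>(M \<Otimes>\<^sub>M unif))"
    unfolding joining_def using bmeas_measurable[OF assms]
    by (intro integral_distr) (auto cong: measurable_cong_sets)
  also have "\<dots> = (\<integral>x. fibre F x \<partial>M)"
    using P.integral_fst'[OF P.bmeas_integrable[OF bmeas_lift[OF assms]]] by (simp add: fibre_def lift_def)
  finally show ?thesis .
qed

lemma AE_joining:
  assumes "AE w in joining. P w"
  shows "AE x in M. AE t in unif. P (x, Y x t)"
proof -
  have "AE w in M \<Otimes>\<^sub>M unif. P (lift w)"
    using assms unfolding joining_def by (intro AE_distrD[of lift _ "M \<Otimes>\<^sub>M M"]) auto
  then show ?thesis using P.AE_pair[of "\<lambda>w. P (lift w)"] by (simp add: lift_def)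
qed

lemma bmeas_tensor:
  assumes "bmeas M a" "bmeas M b"
  shows "bmeas joining (\<lambda>w. a (fst w) * b (snd w))"
  unfolding bmeas_joining
  by (intro bmeas_mult bmeas_compose[OF assms(1)] bmeas_compose[OF assms(2)]) measurable

lemma integral_tensor:
  assumes "bmeas M a" "bmeas M b"
  shows "(\<integral>w. a (fst w) * b (snd w) \<partial>joining) = (\<integral>x. a x * erg S b x \<partial>M)"
  unfolding integral_joining[OF bmeas_tensor[OF assms]]
  using Y_law[OF assms] by (simp add: fibre_def[abs_def])

text \<open>Rectangles are an intersection-stable generator of the product sigma-algebra, so
  integrals of products of indicators determine the measure.\<close>

lemma mp_map_joiningI:
  assumes R[measurable]: "R \<in> measurable (M \<Otimes>\<^sub>M M) (M \<Otimes>\<^sub>M M)"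
    and eq: "\<And>A B. A \<in> sets M \<Longrightarrow> B \<in> sets M \<Longrightarrow>
      (\<integral>w. indicator A (fst (R w)) * indicator B (snd (R w)) \<partial>joining)
        = (\<integral>w. indicator A (fst w) * indicator B (snd w) \<partial>joining :: real)"
  shows "mp_map joining R"
  unfolding mp_map_def
proof
  show Rm: "R \<in> measurable joining joining" by measurable
  let ?E = "{A \<times> B |A B. A \<in> sets M \<and> B \<in> sets M}"
  show "distr joining joining R = joining"
  proof (rule measure_eqI_generator_eq[where A="\<lambda>_. space M \<times> space M"])
    show "Int_stable ?E" by (rule Int_stable_pair_measure_generator)
    show "?E \<subseteq> Pow (space M \<times> space M)" using sets.space_closed by blast
    show "sets (distr joining joining R) = sigma_sets (space M \<times> space M) ?E"
      "sets joining = sigma_sets (space M \<times> space M) ?E"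
      by (simp_all add: sets_pair_measure)
    show "emeasure (distr joining joining R) (space M \<times> space M) \<noteq> \<infinity>" for i :: nat
      using Rm by (simp add: emeasure_distr J.emeasure_eq_measure)
    fix X assume "X \<in> ?E"
    then obtain A B where X: "X = A \<times> B" and [measurable]: "A \<in> sets M" "B \<in> sets M" by auto
    have ind: "indicator A (fst w) * indicator B (snd w) = (indicator X w :: real)" for w :: "'a \<times> 'a"
      by (cases w) (auto simp: X indicator_def)
    have [measurable]: "X \<in> sets joining" by (simp add: X)
    interpret D: prob_space "distr joining joining R" by (rule J.prob_space_distr) fact
    have sub: "X \<subseteq> space joining" using sets.sets_into_space \<open>X \<in> sets joining\<close> by blast
    have "measure (distr joining joining R) X = (\<integral>w. indicator X w \<partial>distr joining joining R)"
      using sub by (simp add: Int_absorb2)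
    also have "\<dots> = (\<integral>w. indicator X (R w) \<partial>joining)"
      by (rule integral_distr) (use Rm in auto)
    also have "\<dots> = measure joining X"
      using eq[of A B] sub by (simp add: ind Int_absorb2)
    finally show "emeasure (distr joining joining R) X = emeasure joining X"
      by (simp add: D.emeasure_eq_measure J.emeasure_eq_measure)
  qed auto
qed

section \<open>Two measure preserving maps of the joining\<close>

definition SI :: "'a \<times> 'a \<Rightarrow> 'a \<times> 'a" where "SI w = (S (fst w), snd w)"
definition TT :: "'a \<times> 'a \<Rightarrow> 'a \<times> 'a" where "TT w = (T (fst w), T (snd w))"

lemma funpow_SI: "(SI ^^ i) w = ((S ^^ i) (fst w), snd w)"
  by (induction i) (auto simp: SI_def)

lemma funpow_TT: "(TT ^^ i) w = ((T ^^ i) (fst w), (T ^^ i) (snd w))"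
  by (induction i) (auto simp: TT_def)

text \<open>The second factor enters the integral through \<open>erg S (indicator B)\<close>, which
  is S-invariant, so shifting the first coordinate alone amounts to applying S to the whole
  integrand.\<close>

lemma mp_map_SI: "mp_map joining SI"
proof (rule mp_map_joiningI)
  show "SI \<in> measurable (M \<Otimes>\<^sub>M M) (M \<Otimes>\<^sub>M M)" unfolding SI_def[abs_def] by measurable
  fix A B assume [measurable]: "A \<in> sets M" "B \<in> sets M"
  have A: "bmeas M (indicator A)" and B: "bmeas M (indicator B)" by (auto intro: bmeas_indicator)
  have AS: "bmeas M (\<lambda>x. indicator A (S x))" by (rule bmeas_compose[OF A]) measurable
  have "(\<integral>w. indicator A (fst (SI w)) * indicator B (snd (SI w)) \<partial>joining) = (\<integral>x. indicator A (S x) * erg S (indicator B) x \<partial>M)"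
    using integral_tensor[OF AS B] by (simp add: SI_def)
  also have "\<dots> = (\<integral>x. indicator A (S x) * erg S (indicator B) (S x) \<partial>M)"
    by (simp add: erg_invariant[OF B])
  also have "\<dots> = (\<integral>x. indicator A x * erg S (indicator B) x \<partial>M)"
    by (rule mp_map_integral[OF S]) (intro bmeas_measurable bmeas_mult A bmeas_erg S B)
  finally show "(\<integral>w. indicator A (fst (SI w)) * indicator B (snd (SI w)) \<partial>joining)
        = (\<integral>w. indicator A (fst w) * indicator B (snd w) \<partial>joining :: real)"
    using integral_tensor[OF A B] by simp
qed

text \<open>Since T commutes with S it commutes with \<open>erg S\<close>, so T acts on the whole
  integrand and preserves its integral.\<close>

lemma mp_map_TT: "mp_map joining TT"
proof (rule mp_map_joiningI)
  show "TT \<in> measurable (M \<Otimes>\<^sub>M M) (M \<Otimes>\<^sub>M M)" unfolding TT_def[abs_def] by measurable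
  fix A B assume [measurable]: "A \<in> sets M" "B \<in> sets M"
  have A: "bmeas M (indicator A)" and B: "bmeas M (indicator B)" by (auto intro: bmeas_indicator)
  have AT: "bmeas M (\<lambda>x. indicator A (T x))" by (rule bmeas_compose[OF A]) measurable
  have BT: "bmeas M (\<lambda>x. indicator B (T x))" by (rule bmeas_compose[OF B]) measurable
  have "(\<integral>w. indicator A (fst (TT w)) * indicator B (snd (TT w)) \<partial>joining) = 
      (\<integral>x. indicator A (T x) * erg S (\<lambda>x. indicator B (T x)) x \<partial>M)"
    using integral_tensor[OF AT BT] by (simp add: TT_def)
  also have "\<dots> = (\<integral>x. indicator A (T x) * erg S (indicator B) (T x) \<partial>M)"
    using erg_commute[of T S "indicator B"] S_T by simp
  also have "\<dots> = (\<integral>x. indicator A x * erg S (indicator B) x \<partial>M)"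
    by (rule mp_map_integral[OF T]) (intro bmeas_measurable bmeas_mult A bmeas_erg S B)
  finally show "(\<integral>w. indicator A (fst (TT w)) * indicator B (snd (TT w)) \<partial>joining)
        = (\<integral>w. indicator A (fst w) * indicator B (snd w) \<partial>joining :: real)"
    using integral_tensor[OF A B] by simp
qed

lemma fibre_cmult_fst: "fibre (\<lambda>w. h (fst w) * F w) x = h x * fibre F x"
  by (simp add: fibre_def)

text \<open>Tested against a function a of x, both sides become integrals over the joining, and
  invariance under \<open>TT\<close> together with the inverse \<open>T'\<close> matches them. In
  terms of laws, T carries the conditional law at x to the one at T x.\<close>

lemma fibre_TT:
  assumes F: "bmeas joining F"
  shows "AE x in M. fibre (\<lambda>w. F (TT w)) x = fibre F (T x)"
proof (rule eq_of_integral_mult_eq)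
  have FT: "bmeas joining (\<lambda>w. F (TT w))"
    by (rule bmeas_compose[OF F mp_mapD(1)[OF mp_map_TT]])
  show "bmeas M (fibre (\<lambda>w. F (TT w)))" by (rule bmeas_fibre[OF FT])
  show "bmeas M (\<lambda>x. fibre F (T x))" by (rule bmeas_compose[OF bmeas_fibre[OF F] T_meas])
  fix a assume a: "bmeas M a"
  have a': "bmeas M (\<lambda>x. a (T' x))" by (rule bmeas_compose[OF a T'_meas])
  have fst: "bmeas joining (\<lambda>w. h (fst w))" if "bmeas M h" for h
    unfolding bmeas_joining by (rule bmeas_compose[OF that]) measurable
  have aF: "bmeas joining (\<lambda>w. a (fst w) * F (TT w))" by (intro bmeas_mult fst a FT)
  have a'F: "bmeas joining (\<lambda>w. a (T' (fst w)) * F w)" by (intro bmeas_mult fst[OF a'] F)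
  have "(\<integral>x. a x * fibre (\<lambda>w. F (TT w)) x \<partial>M) = (\<integral>w. a (fst w) * F (TT w) \<partial>joining)"
    by (simp add: integral_joining[OF aF] fibre_cmult_fst[of a, abs_def])
  also have "\<dots> = (\<integral>w. (\<lambda>w. a (T' (fst w)) * F w) (TT w) \<partial>joining)"
    by (simp add: TT_def)
  also have "\<dots> = (\<integral>w. a (T' (fst w)) * F w \<partial>joining)"
    by (rule mp_map_integral[OF mp_map_TT bmeas_measurable[OF a'F]])
  also have "\<dots> = (\<integral>x. a (T' x) * fibre F x \<partial>M)"
    by (simp add: integral_joining[OF a'F] fibre_cmult_fst[of "\<lambda>x. a (T' x)"])
  also have "\<dots> = (\<integral>x. a (T' (T x)) * fibre F (T x) \<partial>M)"
    by (rule mp_map_integral[OF T, symmetric]) (intro bmeas_measurable bmeas_mult a' bmeas_fibre F)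
  finally show "(\<integral>x. a x * fibre (\<lambda>w. F (TT w)) x \<partial>M) = (\<integral>x. a x * fibre F (T x) \<partial>M)" by simp
qed

lemma fibre_TT_funpow:
  assumes F: "bmeas joining F"
  shows "AE x in M. fibre (\<lambda>w. F ((TT ^^ j) w)) x = fibre F ((T ^^ j) x)"
proof (induction j)
  case (Suc j)
  have "bmeas joining (\<lambda>w. F ((TT ^^ j) w))"
    by (rule bmeas_compose[OF F funpow_measurable[OF mp_map_TT]])
  from fibre_TT[OF this] mp_map_AE[OF T Suc]
  show ?case by eventually_elim (simp add: funpow_swap1)
qed simp

end

section \<open>The uniformity bound\<close>

lemma sum_sq_le: "(\<Sum>i<(n::nat). u i :: real)\<^sup>2 \<le> real n * (\<Sum>i<n. (u i)\<^sup>2)"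
  using Cauchy_Schwarz_ineq_sum[of "\<lambda>_. 1" u "{..<n}"] by simp

text \<open>Cauchy-Schwarz in k removes b. Expanding the square of \<open>u k\<close> over pairs h,
  h' and taking absolute values of the sums over k removes a.\<close>

lemma box_cauchy_schwarz:
  fixes a b :: "nat \<Rightarrow> real" and c :: "nat \<Rightarrow> nat \<Rightarrow> real"
  assumes a: "\<And>h. \<bar>a h\<bar> \<le> 1" and b: "\<And>k. \<bar>b k\<bar> \<le> 1"
  shows "(\<Sum>h<H. \<Sum>k<K. a h * b k * c h k)\<^sup>2 \<le>
    real K * (\<Sum>h<H. \<Sum>h'<H. \<bar>\<Sum>k<K. c h k * c h' k\<bar>)"
proof -
  define u where "u k = (\<Sum>h<H. a h * c h k)" for k
  have "(\<Sum>h<H. \<Sum>k<K. a h * b k * c h k) = (\<Sum>k<K. b k * u k)"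
    unfolding u_def sum_distrib_left by (subst sum.swap) (simp add: mult_ac)
  then have "(\<Sum>h<H. \<Sum>k<K. a h * b k * c h k)\<^sup>2 \<le> (\<Sum>k<K. (b k)\<^sup>2) * (\<Sum>k<K. (u k)\<^sup>2)"
    using Cauchy_Schwarz_ineq_sum[of b u "{..<K}"] by simp
  also have "\<dots> \<le> real K * (\<Sum>k<K. (u k)\<^sup>2)"
  proof (rule mult_right_mono)
    have "(b k)\<^sup>2 \<le> 1" for k using b[of k] by (simp add: abs_square_le_1)
    then have "(\<Sum>k<K. (b k)\<^sup>2) \<le> (\<Sum>k<K. 1)" by (intro sum_mono)
    then show "(\<Sum>k<K. (b k)\<^sup>2) \<le> real K" by simp
  qed (simp add: sum_nonneg)
  also have "(\<Sum>k<K. (u k)\<^sup>2) \<le> (\<Sum>h<H. \<Sum>h'<H. \<bar>\<Sum>k<K. c h k * c h' k\<bar>)"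
  proof -
    have "(\<Sum>k<K. (u k)\<^sup>2) = (\<Sum>k<K. \<Sum>h<H. \<Sum>h'<H. a h * a h' * (c h k * c h' k))"
      by (simp add: u_def power2_eq_square sum_product mult_ac)
    also have "\<dots> = (\<Sum>h<H. \<Sum>k<K. \<Sum>h'<H. a h * a h' * (c h k * c h' k))"
      by (rule sum.swap)
    also have "\<dots> = (\<Sum>h<H. \<Sum>h'<H. \<Sum>k<K. a h * a h' * (c h k * c h' k))"
      by (intro sum.cong refl sum.swap)
    also have "\<dots> \<le> (\<Sum>h<H. \<Sum>h'<H. \<bar>\<Sum>k<K. c h k * c h' k\<bar>)"
    proof (intro sum_mono)
      fix h h'
      have "(\<Sum>k<K. a h * a h' * (c h k * c h' k)) \<le> \<bar>a h * a h'\<bar> * \<bar>\<Sum>k<K. c h k * c h' k\<bar>"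
        unfolding sum_distrib_left[symmetric] abs_mult[symmetric] by (rule abs_ge_self)
      also have "\<dots> \<le> 1 * \<bar>\<Sum>k<K. c h k * c h' k\<bar>"
        using mult_mono[OF a a, of h h'] by (intro mult_right_mono) (auto simp: abs_mult mult.commute)
      finally show "(\<Sum>k<K. a h * a h' * (c h k * c h' k)) \<le> \<bar>\<Sum>k<K. c h k * c h' k\<bar>" by simp
    qed
    finally show ?thesis .
  qed
  finally show ?thesis by (simp add: mult_left_mono)
qed

text \<open>Each unit shift exchanges one term at either end.\<close>

lemma sum_shift_le:
  fixes z :: "nat \<Rightarrow> real"
  assumes "\<And>i. \<bar>z i\<bar> \<le> V"
  shows "\<bar>(\<Sum>i<N. z (i + h)) - (\<Sum>i<N. z i)\<bar> \<le> 2 * real h * V"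
proof (induction h)
  case (Suc h)
  have "(\<Sum>i<N. z (i + Suc h)) - (\<Sum>i<N. z (i + h)) = z (N + h) - z h"
    using sum_lessThan_telescope[of "\<lambda>i. z (i + h)" N] by (simp add: sum_subtractf)
  moreover have "\<bar>z (N + h) - z h\<bar> \<le> 2 * V" using assms[of "N + h"] assms[of h] by linarith
  ultimately show ?case using Suc by (simp add: algebra_simps abs_le_iff) 
qed simp

section \<open>Averages over squares of doubly indexed sequences\<close>

definition davg :: "(nat \<Rightarrow> nat \<Rightarrow> real) \<Rightarrow> nat \<Rightarrow> real" where
  "davg z N = (\<Sum>i<N. \<Sum>j<N. z i j) / (real N)\<^sup>2"

lemma davg_cmult: "davg (\<lambda>i j. c * z i j) N = c * davg z N"
  by (simp add: davg_def sum_distrib_left)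

lemma davg_add: "davg (\<lambda>i j. z i j + z' i j) N = davg z N + davg z' N"
  by (simp add: davg_def sum.distrib add_divide_distrib)

lemma davg_sum: "davg (\<lambda>i j. \<Sum>h\<in>I. z h i j) N = (\<Sum>h\<in>I. davg (z h) N)"
  by (induction I rule: infinite_finite_induct) (simp_all add: davg_add davg_def[of "\<lambda>i j. 0"])

lemma davg_mono: "(\<And>i j. z i j \<le> z' i j) \<Longrightarrow> davg z N \<le> davg z' N"
  by (simp add: davg_def divide_right_mono sum_mono)

lemma abs_davg_le:
  assumes "\<And>i j. \<bar>z i j\<bar> \<le> V"
  shows "\<bar>davg z N\<bar> \<le> V"
proof (cases "N = 0")
  case True
  then show ?thesis using order_trans[OF abs_ge_zero assms] by (simp add: davg_def)
next
  case False
  have "\<bar>\<Sum>i<N. \<Sum>j<N. z i j\<bar> \<le> (\<Sum>i<N. \<Sum>j<N. V)"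
    by (intro order_trans[OF sum_abs] sum_mono assms)
  then show ?thesis using False by (simp add: davg_def field_simps power2_eq_square)
qed

lemma davg_sq_le: "(davg z N)\<^sup>2 \<le> davg (\<lambda>i j. (z i j)\<^sup>2) N"
proof -
  have "(\<Sum>i<N. \<Sum>j<N. z i j)\<^sup>2 \<le> real N * (\<Sum>i<N. (\<Sum>j<N. z i j)\<^sup>2)"
    by (rule sum_sq_le)
  also have "\<dots> \<le> real N * (\<Sum>i<N. real N * (\<Sum>j<N. (z i j)\<^sup>2))"
    by (intro mult_left_mono sum_mono sum_sq_le) simp
  also have "\<dots> = (real N)\<^sup>2 * (\<Sum>i<N. \<Sum>j<N. (z i j)\<^sup>2)"
    by (simp add: sum_distrib_left power2_eq_square mult_ac)
  finally have *: "(\<Sum>i<N. \<Sum>j<N. z i j)\<^sup>2 \<le> (real N)\<^sup>2 * (\<Sum>i<N. \<Sum>j<N. (z i j)\<^sup>2)" .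
  show ?thesis
  proof (cases "N = 0")
    case False
    then show ?thesis using * by (simp add: davg_def power_divide field_simps power2_eq_square)
  qed (simp add: davg_def)
qed

text \<open>A shift by (h, k) affects on the order of (h + k) N terms near the boundary of a square
  with N^2 terms.\<close>

lemma davg_shift_tendsto:
  assumes V: "\<And>i j. \<bar>z i j\<bar> \<le> V"
  shows "(\<lambda>N. davg z N - davg (\<lambda>i j. z (i + h) (j + k)) N) \<longlonglongrightarrow> 0"
proof (rule Lim_null_comparison)
  show "(\<lambda>N. 2 * real (h + k) * V / real N) \<longlonglongrightarrow> 0"
    by (intro real_tendsto_divide_at_top[OF tendsto_const] filterlim_real_sequentially)
  have "norm (davg z N - davg (\<lambda>i j. z (i + h) (j + k)) N) \<le> 2 * real (h + k) * V / real N" if N: "N > 0" for N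
  proof -
    have "\<bar>(\<Sum>i<N. \<Sum>j<N. z (i + h) (j + k)) - (\<Sum>i<N. \<Sum>j<N. z (i + h) j)\<bar>
      \<le> (\<Sum>i<N. 2 * real k * V)"
      unfolding sum_subtractf[symmetric]
      by (rule order_trans[OF sum_abs sum_mono], unfold sum_subtractf) (rule sum_shift_le[OF V])
    moreover have "(\<Sum>i<N. \<Sum>j<N. z (i + h) j) = (\<Sum>j<N. \<Sum>i<N. z (i + h) j)"
        "(\<Sum>i<N. \<Sum>j<N. z i j) = (\<Sum>j<N. \<Sum>i<N. z i j)"
      by (rule sum.swap)+
    moreover have "\<bar>(\<Sum>j<N. \<Sum>i<N. z (i + h) j) - (\<Sum>j<N. \<Sum>i<N. z i j)\<bar> \<le> (\<Sum>j<N. 2 * real h * V)"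
      unfolding sum_subtractf[symmetric]
      by (rule order_trans[OF sum_abs sum_mono], unfold sum_subtractf) (rule sum_shift_le[of "\<lambda>i. z i _", OF V])
    ultimately have "\<bar>(\<Sum>i<N. \<Sum>j<N. z i j) - (\<Sum>i<N. \<Sum>j<N. z (i + h) (j + k))\<bar> \<le> real N * (2 * real (h + k) * V)"
      by (simp add: distrib_left distrib_right mult.assoc mult.left_commute abs_le_iff)
    then have "\<bar>(\<Sum>i<N. \<Sum>j<N. z i j) - (\<Sum>i<N. \<Sum>j<N. z (i + h) (j + k))\<bar> / (real N)\<^sup>2
       \<le> real N * (2 * real (h + k) * V) / (real N)\<^sup>2"
      by (intro divide_right_mono) auto
    then show ?thesis using N
      by (simp add: davg_def diff_divide_distrib[symmetric] power2_eq_square)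
  qed
  then show "\<forall>\<^sub>F N in sequentially. norm (davg z N - davg (\<lambda>i j. z (i + h) (j + k)) N) \<le> 2 * real (h + k) * V / real N"
    by (intro eventually_mono[OF eventually_gt_at_top[of 0]])
qed

text \<open>Up to a null sequence the average of z is the average \<open>m\<close> of its means over
  H by K boxes. By convexity the square of \<open>m\<close> is at most the average of the squared
  box means, hence that of B.\<close>

lemma davg_sq_eventually_le:
  assumes V: "\<And>i j. \<bar>z i j\<bar> \<le> V" and HK: "H > 0" "K > 0"
    and B: "\<And>i j. ((\<Sum>h<H. \<Sum>k<K. z (i + h) (j + k)) / (real H * real K))\<^sup>2 \<le> B i j"
    and lim: "(\<lambda>N. davg B N) \<longlonglongrightarrow> \<beta>" and e: "\<beta> < e"
  shows "eventually (\<lambda>N. (davg z N)\<^sup>2 < e) sequentially"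
proof -
  define m where "m N = davg (\<lambda>i j. (\<Sum>h<H. \<Sum>k<K. z (i + h) (j + k)) / (real H * real K)) N" for N
  have m: "m N = (\<Sum>h<H. \<Sum>k<K. davg (\<lambda>i j. z (i + h) (j + k)) N) / (real H * real K)" for N
    unfolding m_def using davg_cmult[of "1 / (real H * real K)"] by (simp add: davg_sum)
  have "(\<lambda>N. (\<Sum>h<H. \<Sum>k<K. davg z N - davg (\<lambda>i j. z (i + h) (j + k)) N) / (real H * real K)) \<longlonglongrightarrow> 
     (\<Sum>h<H. \<Sum>k<K. 0) / (real H * real K)"
    by (intro tendsto_divide tendsto_sum davg_shift_tendsto[OF V] tendsto_const) (use HK in auto)
  then have dm: "(\<lambda>N. davg z N - m N) \<longlonglongrightarrow> 0"
    using HK by (simp add: m sum_subtractf diff_divide_distrib)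
  have mb: "\<bar>m N\<bar> \<le> V" for N
    unfolding m_def
  proof (rule abs_davg_le)
    fix i j
    have "\<bar>\<Sum>h<H. \<Sum>k<K. z (i + h) (j + k)\<bar> \<le> (\<Sum>h<H. \<Sum>k<K. V)"
      by (intro order_trans[OF sum_abs] sum_mono V)
    then show "\<bar>(\<Sum>h<H. \<Sum>k<K. z (i + h) (j + k)) / (real H * real K)\<bar> \<le> V"
      using HK by (simp add: field_simps)
  qed
  have "(\<lambda>N. (davg z N)\<^sup>2 - (m N)\<^sup>2) \<longlonglongrightarrow> 0"
  proof (rule Lim_null_comparison)
    show "\<forall>\<^sub>F N in sequentially. norm ((davg z N)\<^sup>2 - (m N)\<^sup>2) \<le> \<bar>davg z N - m N\<bar> * (2 * V)"
    proof (rule always_eventually, rule allI)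
      fix N
      have "(davg z N)\<^sup>2 - (m N)\<^sup>2 = (davg z N - m N) * (davg z N + m N)"
        by (simp add: power2_eq_square algebra_simps)
      moreover have "\<bar>davg z N + m N\<bar> \<le> 2 * V"
        using abs_davg_le[of z V N, OF V] mb[of N] by linarith
      ultimately show "norm ((davg z N)\<^sup>2 - (m N)\<^sup>2) \<le> \<bar>davg z N - m N\<bar> * (2 * V)"
        by (simp add: abs_mult mult_left_mono)
    qed
    show "(\<lambda>N. \<bar>davg z N - m N\<bar> * (2 * V)) \<longlonglongrightarrow> 0"
      by (intro tendsto_mult_left_zero tendsto_rabs_zero dm)
  qed
  \<comment> \<open>The square of \<open>davg z N\<close> is at most this expression, whose limit
    lies below e.\<close>
  from tendsto_add[OF this lim] have "(\<lambda>N. (davg z N)\<^sup>2 - (m N)\<^sup>2 + davg B N) \<longlonglongrightarrow> \<beta>" by simp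
  from order_tendstoD(2)[OF this e] show ?thesis
  proof eventually_elim
    case (elim N)
    have "(m N)\<^sup>2 \<le> davg B N"
      unfolding m_def by (rule order_trans[OF davg_sq_le davg_mono[OF B]])
    then show ?case using elim by linarith
  qed
qed

definition cubic :: "('a \<Rightarrow> 'a) \<Rightarrow> ('a \<Rightarrow> 'a) \<Rightarrow> ('a \<Rightarrow> real) \<Rightarrow> ('a \<Rightarrow> real) \<Rightarrow> ('a \<Rightarrow> real) \<Rightarrow> 'a \<Rightarrow> nat \<Rightarrow> nat \<Rightarrow> real" where
  "cubic S T f1 f2 f3 x i j = f1 ((S ^^ i) x) * f2 ((T ^^ j) x) * f3 ((S ^^ i) ((T ^^ j) x))"

lemma (in prob_space) AE_davg:
  assumes S: "mp_map M S" and T: "mp_map M T" and comm: "\<And>x. S (T x) = T (S x)"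
    and erg: "ergodic2 M S T" and F: "bmeas M F"
  shows "AE x in M. (\<lambda>N. davg (\<lambda>i j. F ((S ^^ i) ((T ^^ j) x))) N) \<longlonglongrightarrow> integral\<^sup>L M F"
proof -
  have "davg (\<lambda>i j. F ((S ^^ i) ((T ^^ j) x))) N = ravg S (ravg T F N) N x" for x N
    by (simp add: davg_def ravg_def funpow_commute2[of S T, OF comm] sum_divide_distrib power2_eq_square)
  then show ?thesis using AE_ravg_ravg[OF S T comm erg F] by simp
qed

section \<open>Correlations along T and the bound by box averages\<close>

context self_joining
begin

definition corr :: "('a \<Rightarrow> real) \<Rightarrow> nat \<Rightarrow> 'a \<times> 'a \<Rightarrow> real" where
  "corr v = ravg TT (\<lambda>w. v (fst w) * v (snd w))"

text \<open>This is the bound of \<open>box_cauchy_schwarz\<close> for the H by K box with corner x,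
  divided by (H K)^2; it no longer involves f1 and f2.\<close>

definition box_avg :: "('a \<Rightarrow> real) \<Rightarrow> nat \<Rightarrow> nat \<Rightarrow> 'a \<Rightarrow> real" where
  "box_avg v H K x = (\<Sum>h<H. \<Sum>h'<H. \<bar>corr v K ((S ^^ h) x, (S ^^ h') x)\<bar>) / (real H)\<^sup>2"

lemma bmeas_corr: "bmeas M v \<Longrightarrow> bmeas joining (corr v K)"
  unfolding corr_def by (intro bmeas_ravg mp_map_TT bmeas_tensor)

lemma bmeas_pair_funpow:
  assumes "bmeas joining F"
  shows "bmeas M (\<lambda>x. F ((S ^^ h) x, (S ^^ h') x))"
proof -
  note [measurable] = funpow_measurable[OF S]
  show ?thesis
    by (rule bmeas_compose[of "M \<Otimes>\<^sub>M M" F "\<lambda>x. ((S ^^ h) x, (S ^^ h') x)"]) (use assms in \<open>simp_all add: bmeas_joining\<close>)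
qed

lemma bmeas_box_avg: "bmeas M v \<Longrightarrow> bmeas M (box_avg v H K)"
  unfolding box_avg_def[abs_def] divide_inverse
  by (intro bmeas_mult bmeas_const bmeas_sum bmeas_abs bmeas_pair_funpow bmeas_corr)

text \<open>In a box with corner (i, j) the factor from f1 depends on h alone and that from f2 on k
  alone, so \<open>box_cauchy_schwarz\<close> applies; the averages of \<open>box_avg\<close> over
  the orbit converge to its integral. One exceptional set serves all H, K and e, so H and K can be
  chosen later.\<close>

lemma AE_cubic_box:
  assumes f1: "\<And>x. \<bar>f1 x\<bar> \<le> 1" and f2: "\<And>x. \<bar>f2 x\<bar> \<le> 1" and v: "bmeas M v"
  shows "AE x in M. \<forall>H>0. \<forall>K>0. \<forall>e. integral\<^sup>L M (box_avg v H K) < e \<longrightarrow>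
    eventually (\<lambda>N. (davg (cubic S T f1 f2 v x) N)\<^sup>2 < e) sequentially"
proof -
  obtain V where V: "V \<ge> 0" "\<And>x. \<bar>v x\<bar> \<le> V" using v by (metis bmeas_bound)
  have "AE x in M. \<forall>H K. (\<lambda>N. davg (\<lambda>i j. box_avg v H K ((S ^^ i) ((T ^^ j) x))) N) \<longlonglongrightarrow> integral\<^sup>L M (box_avg v H K)"
    unfolding AE_all_countable by (intro allI AE_davg S T S_T ergodic bmeas_box_avg v)
  then show ?thesis
  proof eventually_elim
    case (elim x)
    show ?case
    proof (intro allI impI)
      fix H K :: nat and e :: real assume HK: "0 < H" "0 < K" and e: "integral\<^sup>L M (box_avg v H K) < e"
      define z where "z = cubic S T f1 f2 v x"
      have zV: "\<bar>z i j\<bar> \<le> V" for i j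
        unfolding z_def cubic_def abs_mult
        using mult_mono[OF mult_mono[OF f1 f2] V(2)] by simp
      have zB: "((\<Sum>h<H. \<Sum>k<K. z (i + h) (j + k)) / (real H * real K))\<^sup>2 \<le> box_avg v H K ((S ^^ i) ((T ^^ j) x))" for i j
      proof -
        define c where "c h k = v ((S ^^ (i + h)) ((T ^^ (j + k)) x))" for h k
        have "(\<Sum>h<H. \<Sum>k<K. z (i + h) (j + k))\<^sup>2 \<le> real K * (\<Sum>h<H. \<Sum>h'<H. \<bar>\<Sum>k<K. c h k * c h' k\<bar>)"
          unfolding z_def cubic_def c_def by (rule box_cauchy_schwarz) (rule f1 f2)+
        moreover have "box_avg v H K ((S ^^ i) ((T ^^ j) x)) = (\<Sum>h<H. \<Sum>h'<H. \<bar>\<Sum>k<K. c h k * c h' k\<bar>) / (real K * (real H)\<^sup>2)"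
        proof -
          have "v ((T ^^ k) ((S ^^ h) ((S ^^ i) ((T ^^ j) x)))) = c h k" for h k
          proof -
            have "(T ^^ k) ((S ^^ h) ((S ^^ i) ((T ^^ j) x))) = (T ^^ k) ((S ^^ (i + h)) ((T ^^ j) x))"
              by (simp add: funpow_add add.commute[of i])
            also have "\<dots> = (S ^^ (i + h)) ((T ^^ (j + k)) x)"
              using funpow_commute2[of T S k "i + h"] S_T by (simp add: funpow_add add.commute[of j])
            finally show ?thesis by (simp add: c_def)
          qed
          then show ?thesis
            by (simp add: box_avg_def corr_def ravg_def funpow_TT sum_divide_distrib[symmetric] abs_divide)
        qed
        ultimately have "((\<Sum>h<H. \<Sum>k<K. z (i + h) (j + k)) / (real H * real K))\<^sup>2
            \<le> real K * (real K * (real H)\<^sup>2 * box_avg v H K ((S ^^ i) ((T ^^ j) x))) / (real H * real K)\<^sup>2"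
          using HK unfolding power_divide by (intro divide_right_mono) auto
        then show ?thesis using HK by (simp add: power2_eq_square)
      qed
      show "eventually (\<lambda>N. (davg (cubic S T f1 f2 v x) N)\<^sup>2 < e) sequentially"
        unfolding z_def[symmetric]
        using davg_sq_eventually_le[of z V H K, OF zV HK zB] elim e by blast
    qed
  qed
qed

section \<open>Sums of tensors, and the joining as a limit of averages over S-orbits\<close>

inductive tensors :: "('a \<times> 'a \<Rightarrow> real) \<Rightarrow> bool" where
  tensor: "bmeas M a \<Longrightarrow> bmeas M b \<Longrightarrow> tensors (\<lambda>w. a (fst w) * b (snd w))"
| add: "tensors F \<Longrightarrow> tensors G \<Longrightarrow> tensors (\<lambda>w. F w + G w)"

lemma tensors_tensor_mult:
  assumes "tensors F" "bmeas M a" "bmeas M b"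
  shows "tensors (\<lambda>w. a (fst w) * b (snd w) * F w)"
  using assms(1)
proof induction
  case (tensor a' b')
  have "tensors (\<lambda>w. (a (fst w) * a' (fst w)) * (b (snd w) * b' (snd w)))"
    using tensors.tensor[OF bmeas_mult[OF assms(2) tensor(1)] bmeas_mult[OF assms(3) tensor(2)]] by simp
  then show ?case by (simp add: mult_ac)
next
  case (add F G)
  then show ?case using tensors.add[OF add.IH] by (simp add: distrib_left)
qed

lemma tensors_mult:
  assumes "tensors F" "tensors G"
  shows "tensors (\<lambda>w. F w * G w)"
  using assms(1)
proof induction
  case (tensor a b)
  then show ?case by (rule tensors_tensor_mult[OF assms(2)])
next
  case (add F F')
  then show ?case using tensors.add[OF add.IH] by (simp add: distrib_right)
qed

lemma tensors_const: "tensors (\<lambda>w. c)"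
  using tensors.tensor[OF bmeas_const[of M c] bmeas_const[of M 1]] by simp

lemma tensors_sum: "finite I \<Longrightarrow> (\<And>i. i \<in> I \<Longrightarrow> tensors (F i)) \<Longrightarrow> tensors (\<lambda>w. \<Sum>i\<in>I. F i w)"
  by (induction I rule: finite_induct) (auto intro: tensors_const tensors.add)

text \<open>With \<open>tensors_corr\<close> this puts polynomials in \<open>corr v K\<close> among
  the finite sums of tensors, whose limits \<open>spread_tensors\<close> computes.\<close>

lemma tensors_polynomial:
  assumes "real_polynomial_function p" "tensors F"
  shows "tensors (\<lambda>w. p (F w))"
  using assms(1)
proof induction
  case (linear f)
  have *: "f t = t * f 1" for t using linear_scale[OF bounded_linear.linear[OF linear], of t 1] by simp
  have "(\<lambda>w. f (F w)) = (\<lambda>w. F w * f 1)" by (rule ext) (rule *)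
  then show ?case using tensors_mult[OF assms(2) tensors_const[of "f 1"]] by simp
qed (auto intro: tensors_const tensors.add tensors_mult)

lemma tensors_corr:
  assumes v: "bmeas M v"
  shows "tensors (corr v K)"
proof -
  have "tensors (\<lambda>w. (\<Sum>k<K. v ((T ^^ k) (fst w)) * v ((T ^^ k) (snd w))) * (1 / real K))"
    by (intro tensors_mult tensors_sum tensors_const tensors.tensor bmeas_compose[OF v] funpow_measurable T) simp
  moreover have "corr v K = (\<lambda>w. (\<Sum>k<K. v ((T ^^ k) (fst w)) * v ((T ^^ k) (snd w))) * (1 / real K))"
    by (simp add: fun_eq_iff corr_def ravg_def funpow_TT)
  ultimately show ?thesis by simp
qed

lemma bmeas_tensors: "tensors F \<Longrightarrow> bmeas joining F"
  by (induction rule: tensors.induct) (auto intro: bmeas_tensor bmeas_add)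

text \<open>This integrates F against the mean of the images of M under x \<mapsto> (S^h x, S^h' x)
  for h, h' < H; these measures approximate the joining.\<close>

definition spread :: "('a \<times> 'a \<Rightarrow> real) \<Rightarrow> nat \<Rightarrow> real" where
  "spread F H = (\<Sum>h<H. \<Sum>h'<H. \<integral>x. F ((S ^^ h) x, (S ^^ h') x) \<partial>M) / (real H)\<^sup>2"

text \<open>For a single tensor the double sum is the integral of a product of two averages along S.
  Their limits are conditional expectations, and the integral of the product of these is that of the
  tensor over the joining.\<close>

lemma spread_tensors:
  assumes "tensors F"
  shows "(\<lambda>H. spread F H) \<longlonglongrightarrow> integral\<^sup>L joining F"
  using assms
proof induction
  case (tensor a b)
  have int: "integrable M (\<lambda>x. a ((S ^^ h) x) * b ((S ^^ h') x))" for h h'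
    by (intro bmeas_integrable bmeas_mult bmeas_compose[OF tensor(1)] bmeas_compose[OF tensor(2)] funpow_measurable S)
  have eq: "spread (\<lambda>w. a (fst w) * b (snd w)) H = (\<integral>x. ravg S a H x * ravg S b H x \<partial>M)" for H
  proof -
    have "(\<integral>x. ravg S a H x * ravg S b H x \<partial>M) = 
      (\<integral>x. (\<Sum>h<H. \<Sum>h'<H. a ((S ^^ h) x) * b ((S ^^ h') x)) / (real H)\<^sup>2 \<partial>M)"
      by (simp add: ravg_def sum_product power2_eq_square)
    also have "\<dots> = spread (\<lambda>w. a (fst w) * b (snd w)) H"
      using int by (simp add: spread_def)
    finally show ?thesis by simp
  qed
  obtain C D where C: "C \<ge> 0" "\<And>x. \<bar>a x\<bar> \<le> C" and D: "\<And>x. \<bar>b x\<bar> \<le> D" using tensor by (metis bmeas_bound)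
  have "(\<lambda>H. \<integral>x. ravg S a H x * ravg S b H x \<partial>M) \<longlonglongrightarrow> (\<integral>x. erg S a x * erg S b x \<partial>M)"
  proof (rule tendsto_integral_bounded)
    show "\<bar>ravg S a H x * ravg S b H x\<bar> \<le> C * D" for H x
      unfolding abs_mult by (intro mult_mono abs_ravg_le C D) auto
    show "AE x in M. (\<lambda>H. ravg S a H x * ravg S b H x) \<longlonglongrightarrow> erg S a x * erg S b x"
      using AE_erg[OF S tensor(1)] AE_erg[OF S tensor(2)]
      by eventually_elim (rule tendsto_mult)
  qed (intro bmeas_mult bmeas_ravg bmeas_erg S tensor)+
  also have "(\<integral>x. erg S a x * erg S b x \<partial>M) = (\<integral>w. a (fst w) * b (snd w) \<partial>joining)"
    using integral_invariant_mult_erg[OF S tensor(1) bmeas_erg[OF S tensor(2)] erg_invariant[OF tensor(2)]]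
    by (simp add: integral_tensor[OF tensor] mult.commute)
  finally show ?case by (simp add: eq)
next
  case (add F G)
  have F: "bmeas joining F" and G: "bmeas joining G" using add bmeas_tensors by auto
  have "spread (\<lambda>w. F w + G w) H = spread F H + spread G H" for H
    by (simp add: spread_def bmeas_integrable bmeas_pair_funpow F G sum.distrib add_divide_distrib)
  moreover have "integral\<^sup>L joining (\<lambda>w. F w + G w) = integral\<^sup>L joining F + integral\<^sup>L joining G"
    by (intro Bochner_Integration.integral_add J.bmeas_integrable F G)
  ultimately show ?case using tendsto_add[OF add.IH] by simp
qed

text \<open>The absolute value is approximated by a polynomial, uniformly on an interval containing
  the range of \<open>corr v K\<close>. Both \<open>spread\<close> and the integral over the joining
  move by at most the uniform distance, and the polynomial in \<open>corr v K\<close> is a sum of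
  tensors.\<close>

lemma spread_abs_corr:
  assumes v: "bmeas M v"
  shows "(\<lambda>H. spread (\<lambda>w. \<bar>corr v K w\<bar>) H) \<longlonglongrightarrow> (\<integral>w. \<bar>corr v K w\<bar> \<partial>joining)"
proof (rule LIMSEQ_I)
  fix e :: real assume e: "e > 0"
  have G: "bmeas joining (corr v K)" by (rule bmeas_corr[OF v])
  obtain C where C: "\<And>w. \<bar>corr v K w\<bar> \<le> C" using G by (metis bmeas_bound)
  obtain p where p: "real_polynomial_function p" "\<And>t. t \<in> {-C..C} \<Longrightarrow> \<bar>\<bar>t\<bar> - p t\<bar> < e / 4"
    by (rule Stone_Weierstrass_real_polynomial_function[of "{-C..C}" abs "e/4"])
       (use e in \<open>auto intro!: continuous_intros\<close>)
  define P where "P w = p (corr v K w)" for w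
  have close: "\<bar>\<bar>corr v K w\<bar> - P w\<bar> \<le> e / 4" for w
    unfolding P_def using C[of w] by (intro less_imp_le p) (auto simp: abs_le_iff)
  have tP: "tensors P" unfolding P_def[abs_def] by (rule tensors_polynomial[OF p(1) tensors_corr[OF v]])
  have P: "bmeas joining P" by (rule bmeas_tensors[OF tP])
  have aG: "bmeas joining (\<lambda>w. \<bar>corr v K w\<bar>)" by (rule bmeas_abs[OF G])
  have int: "\<bar>(\<integral>w. \<bar>corr v K w\<bar> \<partial>joining) - integral\<^sup>L joining P\<bar> \<le> e / 4"
  proof -
    have "\<bar>(\<integral>w. \<bar>corr v K w\<bar> \<partial>joining) - integral\<^sup>L joining P\<bar> = \<bar>\<integral>w. \<bar>corr v K w\<bar> - P w \<partial>joining\<bar>"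
      by (simp add: J.bmeas_integrable aG P)
    also have "\<dots> \<le> (\<integral>w. \<bar>\<bar>corr v K w\<bar> - P w\<bar> \<partial>joining)" by (rule integral_abs_bound)
    also have "\<dots> \<le> (\<integral>w. e / 4 \<partial>joining)"
      by (intro integral_mono J.bmeas_integrable bmeas_intros aG P close)
    finally show ?thesis by (simp add: J.prob_space)
  qed
  have sp: "\<bar>spread (\<lambda>w. \<bar>corr v K w\<bar>) H - spread P H\<bar> \<le> e / 4" for H
  proof -
    have "spread (\<lambda>w. \<bar>corr v K w\<bar>) H - spread P H = davg (\<lambda>h h'. (\<integral>x. \<bar>corr v K ((S ^^ h) x, (S ^^ h') x)\<bar> \<partial>M) - (\<integral>x. P ((S ^^ h) x, (S ^^ h') x) \<partial>M)) H"
      by (simp add: spread_def davg_def sum_subtractf diff_divide_distrib)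
    also have "\<bar>\<dots>\<bar> \<le> e / 4"
    proof (rule abs_davg_le)
      fix h h'
      let ?G = "\<lambda>x. \<bar>corr v K ((S ^^ h) x, (S ^^ h') x)\<bar>" and ?P = "\<lambda>x. P ((S ^^ h) x, (S ^^ h') x)"
      have b: "bmeas M ?G" "bmeas M ?P" by (intro bmeas_pair_funpow[OF aG] bmeas_pair_funpow[OF P])+
      have "\<bar>integral\<^sup>L M ?G - integral\<^sup>L M ?P\<bar> = \<bar>\<integral>x. ?G x - ?P x \<partial>M\<bar>"
        by (simp add: bmeas_integrable b)
      also have "\<dots> \<le> (\<integral>x. \<bar>?G x - ?P x\<bar> \<partial>M)" by (rule integral_abs_bound)
      also have "\<dots> \<le> (\<integral>x. e / 4 \<partial>M)"
        by (intro integral_mono bmeas_integrable bmeas_intros b close)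
      finally show "\<bar>integral\<^sup>L M ?G - integral\<^sup>L M ?P\<bar> \<le> e / 4" by (simp add: prob_space)
    qed
    finally show ?thesis .
  qed
  obtain H0 where H0: "\<And>H. H \<ge> H0 \<Longrightarrow> \<bar>spread P H - integral\<^sup>L joining P\<bar> < e / 4"
    using LIMSEQ_D[OF spread_tensors[OF tP], of "e/4"] e by auto
  then have "norm (spread (\<lambda>w. \<bar>corr v K w\<bar>) H - (\<integral>w. \<bar>corr v K w\<bar> \<partial>joining)) < e" if "H \<ge> H0" for H
    unfolding real_norm_def using H0[OF that] int sp[of H] e by linarith
  then show "\<exists>H0. \<forall>H\<ge>H0. norm (spread (\<lambda>w. \<bar>corr v K w\<bar>) H - (\<integral>w. \<bar>corr v K w\<bar> \<partial>joining)) < e" by blast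
qed

lemma integral_box_avg:
  assumes v: "bmeas M v"
  shows "integral\<^sup>L M (box_avg v H K) = spread (\<lambda>w. \<bar>corr v K w\<bar>) H"
proof -
  have "integrable M (\<lambda>x. \<bar>corr v K ((S ^^ h) x, (S ^^ h') x)\<bar>)" for h h'
    by (intro bmeas_integrable bmeas_abs bmeas_pair_funpow bmeas_corr v)
  then show ?thesis by (simp add: box_avg_def[abs_def] spread_def)
qed

section \<open>The dual function\<close>

definition sgn_kernel :: "('a \<Rightarrow> real) \<Rightarrow> 'a \<times> 'a \<Rightarrow> real" where
  "sgn_kernel v w = sgn (erg TT (\<lambda>w. v (fst w) * v (snd w)) w)"

text \<open>With the sign as kernel, the inner product of v and \<open>dual v\<close> is the
  integral of the absolute value of the projection of v(x) v(y) to the \<open>TT\<close>-invariant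
  functions.\<close>

definition dual :: "('a \<Rightarrow> real) \<Rightarrow> 'a \<Rightarrow> real" where
  "dual v = fibre (\<lambda>w. sgn_kernel v w * v (snd w))"

lemma bmeas_sgn_kernel:
  assumes "bmeas M v"
  shows "bmeas joining (sgn_kernel v)"
proof (rule bmeasI[where C=1])
  note [measurable] = bmeas_measurable[OF bmeas_erg[OF mp_map_TT bmeas_tensor[OF assms assms]]]
  show "sgn_kernel v \<in> borel_measurable joining" unfolding sgn_kernel_def[abs_def] by measurable
  show "\<bar>sgn_kernel v w\<bar> \<le> 1" for w by (simp add: sgn_kernel_def sgn_if)
qed

lemma abs_sgn_kernel_le: "\<bar>sgn_kernel v w\<bar> \<le> 1"
  by (simp add: sgn_kernel_def sgn_if)

lemma sgn_kernel_TT: "bmeas M v \<Longrightarrow> sgn_kernel v (TT w) = sgn_kernel v w"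
  using erg_invariant[OF bmeas_tensor, of v v TT w] by (simp add: sgn_kernel_def)

lemma bmeas_snd: "bmeas M g \<Longrightarrow> bmeas joining (\<lambda>w. g (snd w))"
  using bmeas_tensor[OF bmeas_const[of M 1]] by simp

lemma bmeas_fst: "bmeas M g \<Longrightarrow> bmeas joining (\<lambda>w. g (fst w))"
  using bmeas_tensor[OF _ bmeas_const[of M 1]] by simp

lemma corr_tendsto:
  assumes v: "bmeas M v"
  shows "(\<lambda>K. \<integral>w. \<bar>corr v K w\<bar> \<partial>joining) \<longlonglongrightarrow> (\<integral>x. v x * dual v x \<partial>M)"
proof -
  let ?F = "\<lambda>w. v (fst w) * v (snd w)"
  have F: "bmeas joining ?F" by (rule bmeas_tensor[OF v v])
  obtain C where "C \<ge> 0" and C: "\<And>w. \<bar>?F w\<bar> \<le> C" by (rule bmeas_bound[OF F]) blast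
  have "(\<lambda>K. \<integral>w. \<bar>corr v K w\<bar> \<partial>joining) \<longlonglongrightarrow> (\<integral>w. \<bar>erg TT ?F w\<bar> \<partial>joining)"
  proof (rule J.tendsto_integral_bounded)
    show "\<bar>\<bar>corr v K w\<bar>\<bar> \<le> C" for K w
      using abs_ravg_le[of ?F C TT K w, OF C] by (simp add: corr_def)
    show "AE w in joining. (\<lambda>K. \<bar>corr v K w\<bar>) \<longlonglongrightarrow> \<bar>erg TT ?F w\<bar>"
      using J.AE_erg[OF mp_map_TT F] unfolding corr_def by eventually_elim (rule tendsto_rabs)
  qed (intro bmeas_abs bmeas_corr v bmeas_erg mp_map_TT F)+
  \<comment> \<open>The sign times its argument is the absolute value; as the sign is itself
    \<open>TT\<close>-invariant, the projection can then be dropped.\<close>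
  also have "(\<integral>w. \<bar>erg TT ?F w\<bar> \<partial>joining) = (\<integral>w. sgn_kernel v w * erg TT ?F w \<partial>joining)"
    by (simp add: sgn_kernel_def abs_sgn mult.commute)
  also have "\<dots> = (\<integral>w. sgn_kernel v w * ?F w \<partial>joining)"
    by (rule J.integral_invariant_mult_erg[OF mp_map_TT F bmeas_sgn_kernel[OF v] sgn_kernel_TT[OF v]])
  also have "\<dots> = (\<integral>w. v (fst w) * (sgn_kernel v w * v (snd w)) \<partial>joining)" by (simp add: mult_ac)
  also have "\<dots> = (\<integral>x. v x * dual v x \<partial>M)"
  proof -
    have "bmeas joining (\<lambda>w. v (fst w) * (sgn_kernel v w * v (snd w)))"
      by (intro bmeas_mult bmeas_fst bmeas_snd bmeas_sgn_kernel v)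
    then show ?thesis by (simp add: integral_joining dual_def fibre_cmult_fst[of v, abs_def])
  qed
  finally show ?thesis .
qed

text \<open>The box bound is pushed below e in two stages: first K is chosen for the integral of
  \<open>\<bar>corr v K w\<bar>\<close> over the joining, then H, for this K, for the integral of
  \<open>box_avg\<close>.\<close>

lemma AE_cubic_dual:
  assumes f1: "\<And>x. \<bar>f1 x\<bar> \<le> 1" and f2: "\<And>x. \<bar>f2 x\<bar> \<le> 1" and v: "bmeas M v"
  shows "AE x in M. \<forall>e. (\<integral>x. v x * dual v x \<partial>M) < e \<longrightarrow>
    eventually (\<lambda>N. (davg (cubic S T f1 f2 v x) N)\<^sup>2 < e) sequentially"
  using AE_cubic_box[of f1 f2 v, OF f1 f2 v]
proof eventually_elim
  case (elim x)
  show ?case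
  proof (intro allI impI)
    fix e assume "(\<integral>x. v x * dual v x \<partial>M) < e"
    then have "eventually (\<lambda>K. (\<integral>w. \<bar>corr v K w\<bar> \<partial>joining) < e) sequentially"
      by (rule order_tendstoD(2)[OF corr_tendsto[OF v]])
    from eventually_conj[OF this eventually_gt_at_top[of 0]]
    obtain K where K: "(\<integral>w. \<bar>corr v K w\<bar> \<partial>joining) < e" "K > 0"
      by (auto simp: eventually_sequentially)
    have "eventually (\<lambda>H. spread (\<lambda>w. \<bar>corr v K w\<bar>) H < e) sequentially"
      by (rule order_tendstoD(2)[OF spread_abs_corr[OF v] K(1)])
    from eventually_conj[OF this eventually_gt_at_top[of 0]]
    obtain H where H: "spread (\<lambda>w. \<bar>corr v K w\<bar>) H < e" "H > 0"
      by (auto simp: eventually_sequentially)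
    show "eventually (\<lambda>N. (davg (cubic S T f1 f2 v x) N)\<^sup>2 < e) sequentially"
      using elim K(2) H by (simp add: integral_box_avg[OF v])
  qed
qed

end

section \<open>Convergence\<close>

lemma davg_cubic_add:
  "davg (cubic S T f1 f2 (\<lambda>x. s x + v x) x) N = davg (cubic S T f1 f2 s x) N + davg (cubic S T f1 f2 v x) N"
  unfolding davg_add[symmetric] by (simp add: cubic_def[abs_def] distrib_left)

lemma davg_cubic_cmult:
  "davg (cubic S T f1 f2 (\<lambda>x. c * s x) x) N = c * davg (cubic S T f1 f2 s x) N"
  unfolding davg_cmult[symmetric] by (simp add: cubic_def[abs_def] mult_ac)

lemma convergent_of_approx:
  fixes X :: "nat \<Rightarrow> real"
  assumes "\<And>e. e > 0 \<Longrightarrow> \<exists>Y Z. (\<forall>N. X N = Y N + Z N) \<and> convergent Y \<and> eventually (\<lambda>N. \<bar>Z N\<bar> < e) sequentially"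
  shows "convergent X"
proof (rule Cauchy_convergent, rule metric_CauchyI)
  fix e :: real assume e: "e > 0"
  obtain Y Z where YZ: "\<And>N. X N = Y N + Z N" "convergent Y" "eventually (\<lambda>N. \<bar>Z N\<bar> < e / 3) sequentially"
    using assms[of "e/3"] e by auto
  obtain M1 where M1: "\<And>m n. m \<ge> M1 \<Longrightarrow> n \<ge> M1 \<Longrightarrow> dist (Y m) (Y n) < e / 3"
    using metric_CauchyD[OF convergent_Cauchy[OF YZ(2)], of "e/3"] e by auto
  obtain M2 where M2: "\<And>n. n \<ge> M2 \<Longrightarrow> \<bar>Z n\<bar> < e / 3"
    using YZ(3) by (auto simp: eventually_sequentially)
  have "dist (X m) (X n) < e" if "m \<ge> max M1 M2" "n \<ge> max M1 M2" for m n
  proof -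
    have "dist (Y m) (Y n) < e / 3" "\<bar>Z m\<bar> < e / 3" "\<bar>Z n\<bar> < e / 3" using M1[of m n] M2[of m] M2[of n] that by simp_all
    then show ?thesis unfolding dist_real_def YZ(1) by linarith
  qed
  then show "\<exists>M. \<forall>m\<ge>M. \<forall>n\<ge>M. dist (X m) (X n) < e" by blast
qed

section \<open>Functions for which the averages converge\<close>

context self_joining
begin

lemma AE_funpow_pair:
  assumes "AE x in M. P x"
  shows "AE x in M. \<forall>i j. P ((S ^^ i) ((T ^^ j) x))"
  unfolding AE_all_countable
  by (intro allI mp_map_AE[OF mp_map_funpow[OF T]] mp_map_AE[OF mp_map_funpow[OF S]] assms)

text \<open>By invariance of k the terms on a fibre split into a factor in i, from f1 and k, and a
  factor in j, from f2 and g. So the double average is the fibre integral of an average along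
  \<open>SI\<close> times one along \<open>TT\<close>. Both converge almost everywhere on the
  joining, and dominated convergence passes to the fibre integral.\<close>

lemma AE_cubic_fibre_convergent:
  assumes f1: "bmeas M f1" and f2: "bmeas M f2" and k: "bmeas joining k" "\<And>w. k (TT w) = k w" and g: "bmeas M g"
  shows "AE x in M. convergent (\<lambda>N. davg (cubic S T f1 f2 (fibre (\<lambda>w. k w * g (snd w))) x) N)"
proof -
  define F where "F w = k w * g (snd w)" for w
  have F: "bmeas joining F" unfolding F_def by (intro bmeas_mult k bmeas_snd g)
  have k_inv: "k ((TT ^^ j) w) = k w" for j w by (induction j) (auto simp: k(2))
  define \<alpha> where "\<alpha> w = f1 (fst w) * k w" for w
  define \<beta> where "\<beta> w = f2 (fst w) * g (snd w)" for w
  have \<alpha>: "bmeas joining \<alpha>" unfolding \<alpha>_def by (intro bmeas_mult k bmeas_fst f1)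
  have \<beta>: "bmeas joining \<beta>" unfolding \<beta>_def by (intro bmeas_tensor f2 g)
  define p where "p N w = ravg SI \<alpha> N w * ravg TT \<beta> N w" for N w
  define q where "q w = erg SI \<alpha> w * erg TT \<beta> w" for w
  have p: "bmeas joining (p N)" for N
    unfolding p_def[abs_def] by (intro bmeas_mult bmeas_ravg mp_map_SI mp_map_TT \<alpha> \<beta>)
  have q: "bmeas joining q"
    unfolding q_def[abs_def] by (intro bmeas_mult bmeas_erg mp_map_SI mp_map_TT \<alpha> \<beta>)
  obtain A where A: "A \<ge> 0" "\<And>w. \<bar>\<alpha> w\<bar> \<le> A" by (rule bmeas_bound[OF \<alpha>]) blast
  obtain B where B: "B \<ge> 0" "\<And>w. \<bar>\<beta> w\<bar> \<le> B" by (rule bmeas_bound[OF \<beta>]) blast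
  have pb: "\<bar>p N w\<bar> \<le> A * B" for N w
    unfolding p_def abs_mult by (intro mult_mono abs_ravg_le A B) auto
  have "AE w in joining. (\<lambda>N. p N w) \<longlonglongrightarrow> q w"
    using J.AE_erg[OF mp_map_SI \<alpha>] J.AE_erg[OF mp_map_TT \<beta>]
    unfolding p_def q_def by eventually_elim (rule tendsto_mult)
  from AE_joining[OF this] have lim: "AE x in M. AE t in unif. (\<lambda>N. p N (x, Y x t)) \<longlonglongrightarrow> q (x, Y x t)" .
  have "AE x in M. \<forall>j. fibre (\<lambda>w. F ((TT ^^ j) w)) x = fibre F ((T ^^ j) x)"
    unfolding AE_all_countable by (intro allI fibre_TT_funpow F)
  \<comment> \<open>The fibre identity holds only almost everywhere, yet it is used at all points
    S^i x; S^i preserves M, and there are countably many i.\<close>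
  then have "AE x in M. \<forall>j. fibre (\<lambda>w. F ((TT ^^ j) w)) ((S ^^ i) x) = fibre F ((T ^^ j) ((S ^^ i) x))" for i
    by (rule mp_map_AE[OF mp_map_funpow[OF S]])
  then have "AE x in M. \<forall>i. \<forall>j. fibre (\<lambda>w. F ((TT ^^ j) w)) ((S ^^ i) x) = fibre F ((T ^^ j) ((S ^^ i) x))"
    by (subst AE_all_countable) simp
  with lim AE_space show ?thesis
  proof eventually_elim
    case (elim x)
    \<comment> \<open>The parametrised law at S^i x is the one at x, so in the fibre integral only
      the explicit first coordinate moves.\<close>
    have Y_S': "Y ((S ^^ i) x) t = Y x t" for i t by (induction i) (auto simp: Y_S)
    have fib: "fibre F ((S ^^ i) ((T ^^ j) x)) = (\<integral>t. k ((S ^^ i) x, Y x t) * g ((T ^^ j) (Y x t)) \<partial>unif)" for i j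
    proof -
      have "fibre F ((S ^^ i) ((T ^^ j) x)) = fibre F ((T ^^ j) ((S ^^ i) x))"
        using funpow_commute2[of S T i j x] S_T by simp
      also have "\<dots> = fibre (\<lambda>w. F ((TT ^^ j) w)) ((S ^^ i) x)" using elim by simp
      also have "\<dots> = (\<integral>t. k ((S ^^ i) x, Y x t) * g ((T ^^ j) (Y x t)) \<partial>unif)"
        unfolding fibre_def F_def k_inv by (simp add: Y_S' funpow_TT)
      finally show ?thesis .
    qed
    have eq: "davg (cubic S T f1 f2 (fibre F) x) N = (\<integral>t. p N (x, Y x t) \<partial>unif)" for N
    proof -
      have int: "integrable unif (\<lambda>t. k ((S ^^ i) x, Y x t) * g ((T ^^ j) (Y x t)))" for i j
      proof -
        have "bmeas joining (\<lambda>w. k ((SI ^^ i) w) * g ((T ^^ j) (snd w)))"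
          by (intro bmeas_mult bmeas_compose[OF k(1)] funpow_measurable mp_map_SI bmeas_snd bmeas_compose[OF g] T)
        from bmeas_section[OF this elim(2)] show ?thesis
          by (intro U.bmeas_integrable) (simp add: funpow_SI)
      qed
      have "(\<integral>t. p N (x, Y x t) \<partial>unif) = (\<integral>t. (\<Sum>i<N. \<Sum>j<N. f1 ((S ^^ i) x) * f2 ((T ^^ j) x) *
          (k ((S ^^ i) x, Y x t) * g ((T ^^ j) (Y x t)))) / (real N)\<^sup>2 \<partial>unif)"
        unfolding p_def ravg_def \<alpha>_def \<beta>_def funpow_SI funpow_TT fst_conv snd_conv
          times_divide_times_eq sum_product power2_eq_square by (simp add: mult_ac)
      also have "\<dots> = davg (cubic S T f1 f2 (fibre F) x) N"
        using int by (simp add: davg_def cubic_def fib)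
      finally show ?thesis by simp
    qed
    have "(\<lambda>N. \<integral>t. p N (x, Y x t) \<partial>unif) \<longlonglongrightarrow> (\<integral>t. q (x, Y x t) \<partial>unif)"
      using elim by (intro U.tendsto_integral_bounded[OF bmeas_section[OF p] bmeas_section[OF q] pb]) auto
    then show ?case
      unfolding F_def[symmetric, abs_def] eq convergent_def by blast
  qed
qed

lemma bmeas_dual: "bmeas M v \<Longrightarrow> bmeas M (dual v)"
  unfolding dual_def by (intro bmeas_fibre bmeas_mult bmeas_sgn_kernel bmeas_snd)

text \<open>The kernel is bounded by 1, the variance on each fibre is nonnegative, and the second
  marginal of the joining is M.\<close>

lemma integral_dual_sq_le:
  assumes v: "bmeas M v"
  shows "(\<integral>x. (dual v x)\<^sup>2 \<partial>M) \<le> (\<integral>x. (v x)\<^sup>2 \<partial>M)"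
proof -
  let ?F = "\<lambda>w. sgn_kernel v w * v (snd w)"
  have F: "bmeas joining ?F" by (intro bmeas_mult bmeas_sgn_kernel bmeas_snd v)
  have v2: "bmeas joining (\<lambda>w. (v (snd w))\<^sup>2)" by (intro bmeas_power2 bmeas_snd v)
  have "(\<integral>x. (dual v x)\<^sup>2 \<partial>M) \<le> (\<integral>x. fibre (\<lambda>w. (v (snd w))\<^sup>2) x \<partial>M)"
  proof (rule integral_mono)
    show "integrable M (\<lambda>x. (dual v x)\<^sup>2)" by (intro bmeas_integrable bmeas_power2 bmeas_dual v)
    show "integrable M (fibre (\<lambda>w. (v (snd w))\<^sup>2))" by (intro bmeas_integrable bmeas_fibre v2)
    fix x assume x: "x \<in> space M"
    let ?z = "\<lambda>t. ?F (x, Y x t)"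
    have z: "bmeas unif ?z" by (rule bmeas_section[OF F x])
    have "U.variance ?z = U.expectation (\<lambda>t. (?z t)\<^sup>2) - (U.expectation ?z)\<^sup>2"
      by (intro U.variance_eq U.bmeas_integrable bmeas_power2 z)
    then have "(dual v x)\<^sup>2 \<le> (\<integral>t. (?z t)\<^sup>2 \<partial>unif)"
      using U.variance_positive[of ?z] by (simp add: dual_def fibre_def)
    also have "\<dots> \<le> (\<integral>t. (v (Y x t))\<^sup>2 \<partial>unif)"
    proof (rule integral_mono)
      show "integrable unif (\<lambda>t. (?z t)\<^sup>2)" by (intro U.bmeas_integrable bmeas_power2 z)
      show "integrable unif (\<lambda>t. (v (Y x t))\<^sup>2)"
        using bmeas_section[OF v2 x] by (intro U.bmeas_integrable) simp
      fix t
      have "(sgn_kernel v (x, Y x t))\<^sup>2 \<le> 1" using abs_sgn_kernel_le[of v "(x, Y x t)"] by (simp add: abs_square_le_1)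
      then show "(?z t)\<^sup>2 \<le> (v (Y x t))\<^sup>2"
        using mult_right_mono[of _ 1 "(v (Y x t))\<^sup>2"] by (simp add: power_mult_distrib)
    qed
    finally show "(dual v x)\<^sup>2 \<le> fibre (\<lambda>w. (v (snd w))\<^sup>2) x" by (simp add: fibre_def)
  qed
  also have "\<dots> = (\<integral>x. (v x)\<^sup>2 \<partial>M)"
    using integral_tensor[OF bmeas_const[of M 1] bmeas_power2[OF v]] integral_erg[OF S bmeas_power2[OF v]]
    by (simp add: integral_joining[OF v2])
  finally show ?thesis .
qed

text \<open>The averages converge for every element of the vector space \<open>V\<close> below, which contains all
  functions \<open>dual v\<close>. If \<open>s \<in> V\<close> is nearly closest to \<open>f\<close> in \<open>L\<^sup>2\<close>, then \<open>f - s\<close> is nearly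
  orthogonal to \<open>dual (f - s)\<close>; the bound on its norm does not involve the supremum of \<open>f - s\<close>.\<close>

lemma AE_cubic_convergent_normalized:
  assumes f1: "bmeas M f1" "\<And>x. \<bar>f1 x\<bar> \<le> 1" and f2: "bmeas M f2" "\<And>x. \<bar>f2 x\<bar> \<le> 1" and f: "bmeas M f"
  shows "AE x in M. convergent (\<lambda>N. davg (cubic S T f1 f2 f x) N)"
proof -
  define V where "V = {s. bmeas M s \<and> (AE x in M. convergent (\<lambda>N. davg (cubic S T f1 f2 s x) N))}"
  define d where "d s = (\<integral>x. (f x - s x)\<^sup>2 \<partial>M)" for s
  have V0: "(\<lambda>x. 0) \<in> V"
    by (simp add: V_def bmeas_const davg_def cubic_def convergent_const)
  have Vadd: "(\<lambda>x. s x + c * dual v x) \<in> V" if s: "s \<in> V" and v: "bmeas M v" for s c v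
  proof -
    have "AE x in M. convergent (\<lambda>N. davg (cubic S T f1 f2 (dual v) x) N)"
      unfolding dual_def by (intro AE_cubic_fibre_convergent f1 f2 bmeas_sgn_kernel sgn_kernel_TT v)
    moreover have "AE x in M. convergent (\<lambda>N. davg (cubic S T f1 f2 s x) N)" using s by (simp add: V_def)
    ultimately have "AE x in M. convergent (\<lambda>N. davg (cubic S T f1 f2 (\<lambda>x. s x + c * dual v x) x) N)"
      by eventually_elim (auto simp: davg_cubic_add davg_cubic_cmult intro!: convergent_add convergent_mult convergent_const)
    then show ?thesis using s v by (auto simp: V_def intro!: bmeas_add bmeas_cmult bmeas_dual)
  qed
  have bdd: "bdd_below (d ` V)" by (intro bdd_belowI2[where m=0]) (simp add: d_def)
  define \<delta> where "\<delta> = (INF s\<in>V. d s)"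
  have \<delta>: "\<delta> \<le> d s" if "s \<in> V" for s unfolding \<delta>_def using that bdd by (rule cINF_lower[rotated])
  have approx: "\<exists>s\<in>V. (\<integral>x. (f x - s x) * dual (\<lambda>x. f x - s x) x \<partial>M) < e" if e: "e > 0" for e
  proof -
    define A where "A = d (\<lambda>x. 0)"
    have A: "A \<ge> 0" "\<delta> \<le> A" using \<delta>[OF V0] by (auto simp: A_def d_def)
    \<comment> \<open>The choices give \<eta> + t^2 (A + 1) \<le> 2 t e. Here A + 1 exceeds
      \<open>d s\<close> for the near minimiser s, since \<delta> \<le> A and \<eta> \<le>
      1.\<close>
    define t where "t = e / (A + 1)"
    define \<eta> where "\<eta> = min 1 (t * e)"
    have t: "t > 0" and \<eta>: "\<eta> > 0" "\<eta> \<le> 1" "\<eta> \<le> t * e" using e A by (auto simp: t_def \<eta>_def)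
    have "(INF s\<in>V. d s) < \<delta> + \<eta>" using \<eta> by (simp add: \<delta>_def)
    then obtain s where s: "s \<in> V" "d s < \<delta> + \<eta>"
      using cINF_less_iff[OF _ bdd] V0 by auto
    define v where "v x = f x - s x" for x
    have v: "bmeas M v" unfolding v_def[abs_def] using s by (intro bmeas_diff f) (simp add: V_def)
    have D: "bmeas M (dual v)" by (rule bmeas_dual[OF v])
    \<comment> \<open>The step from s along \<open>dual v\<close> stays in \<open>V\<close>, so it
      cannot bring the squared distance below \<delta>; expanding the square bounds the inner
      product of v and \<open>dual v\<close>.\<close>
    have "\<delta> \<le> d (\<lambda>x. s x + t * dual v x)" by (rule \<delta>[OF Vadd[OF s(1) v]])
    also have "\<dots> = (\<integral>x. (v x)\<^sup>2 - 2 * t * (v x * dual v x) + t\<^sup>2 * (dual v x)\<^sup>2 \<partial>M)"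
      unfolding d_def by (intro Bochner_Integration.integral_cong) (auto simp: v_def power2_eq_square algebra_simps)
    also have "\<dots> = (\<integral>x. (v x)\<^sup>2 \<partial>M) - 2 * t * (\<integral>x. v x * dual v x \<partial>M) + t\<^sup>2 * (\<integral>x. (dual v x)\<^sup>2 \<partial>M)"
      using bmeas_integrable[OF bmeas_power2[OF v]] bmeas_integrable[OF bmeas_power2[OF D]] bmeas_integrable[OF bmeas_mult[OF v D]]
      by simp
    also have "\<dots> \<le> d s - 2 * t * (\<integral>x. v x * dual v x \<partial>M) + t\<^sup>2 * d s"
      using mult_left_mono[OF integral_dual_sq_le[OF v], of "t\<^sup>2"] by (simp add: d_def v_def)
    finally have "2 * t * (\<integral>x. v x * dual v x \<partial>M) \<le> (d s - \<delta>) + t\<^sup>2 * d s" by simp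
    also have "\<dots> < \<eta> + t\<^sup>2 * (A + 1)"
    proof (rule add_less_le_mono)
      show "t\<^sup>2 * d s \<le> t\<^sup>2 * (A + 1)" using s(2) \<eta>(2) A by (intro mult_left_mono) auto
    qed (use s in simp)
    also have "t\<^sup>2 * (A + 1) = t * e" using A by (simp add: t_def power2_eq_square)
    finally have "2 * t * (\<integral>x. v x * dual v x \<partial>M) < 2 * t * e" using \<eta>(3) by simp
    then have "(\<integral>x. v x * dual v x \<partial>M) < e" using t by simp
    then show ?thesis using s(1) unfolding v_def by blast
  qed
  then have "\<forall>n. \<exists>s\<in>V. (\<integral>x. (f x - s x) * dual (\<lambda>x. f x - s x) x \<partial>M) < 1 / real (Suc n)" by simp
  then obtain s where s: "\<And>n. s n \<in> V"
    "\<And>n. (\<integral>x. (f x - s n x) * dual (\<lambda>x. f x - s n x) x \<partial>M) < 1 / real (Suc n)" by metis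
  have "AE x in M. \<forall>n. convergent (\<lambda>N. davg (cubic S T f1 f2 (s n) x) N)"
    using s(1) unfolding AE_all_countable V_def by simp
  moreover have "AE x in M. \<forall>n. eventually (\<lambda>N. (davg (cubic S T f1 f2 (\<lambda>x. f x - s n x) x) N)\<^sup>2 < 1 / real (Suc n)) sequentially"
    unfolding AE_all_countable
  proof
    fix n
    have "bmeas M (\<lambda>x. f x - s n x)" using s(1)[of n] by (intro bmeas_diff f) (simp add: V_def)
    from AE_cubic_dual[of f1 f2, OF f1(2) f2(2) this]
    show "AE x in M. eventually (\<lambda>N. (davg (cubic S T f1 f2 (\<lambda>x. f x - s n x) x) N)\<^sup>2 < 1 / real (Suc n)) sequentially"
      by eventually_elim (use s(2)[of n] in blast)
  qed
  ultimately show ?thesis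
  proof eventually_elim
    case (elim x)
    show ?case
    proof (rule convergent_of_approx)
      fix e :: real assume e: "e > 0"
      \<comment> \<open>The dual bound controls squared averages, hence the comparison with
        e^2.\<close>
      then obtain n where n: "1 / real (Suc n) < e\<^sup>2" using nat_approx_posE[of "e\<^sup>2"] by auto
      have "eventually (\<lambda>N. \<bar>davg (cubic S T f1 f2 (\<lambda>x. f x - s n x) x) N\<bar> < e) sequentially"
        using elim(2)[rule_format, of n]
      proof eventually_elim
        case (elim N)
        then show ?case using n e by (intro power2_less_imp_less[of _ e]) auto
      qed
      moreover have "davg (cubic S T f1 f2 f x) N = davg (cubic S T f1 f2 (s n) x) N + davg (cubic S T f1 f2 (\<lambda>x. f x - s n x) x) N" for N
        using davg_cubic_add[of S T f1 f2 "s n" "\<lambda>x. f x - s n x" x N] by simp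
      ultimately show "\<exists>Y Z. (\<forall>N. davg (cubic S T f1 f2 f x) N = Y N + Z N) \<and> convergent Y \<and> eventually (\<lambda>N. \<bar>Z N\<bar> < e) sequentially"
        using elim(1) by blast
    qed
  qed
qed

section \<open>Passage to arbitrary bounded functions\<close>

lemma AE_cubic_convergent:
  assumes f1: "bmeas M f1" and f2: "bmeas M f2" and f3: "bmeas M f3"
  shows "AE x in M. convergent (\<lambda>N. davg (cubic S T f1 f2 f3 x) N)"
proof -
  have normalize: "\<exists>C. bmeas M (\<lambda>x. f x / C) \<and> (\<forall>x. \<bar>f x / C\<bar> \<le> 1) \<and> C > 0" if f: "bmeas M f" for f
  proof -
    obtain C where C: "C \<ge> 0" "\<And>x. \<bar>f x\<bar> \<le> C" using f by (metis bmeas_bound)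
    \<comment> \<open>The divisor C + 1 is positive even when C = 0.\<close>
    have "\<bar>f x / (C + 1)\<bar> \<le> 1" for x using C(1) C(2)[of x] by (simp add: field_simps)
    moreover have "bmeas M (\<lambda>x. f x / (C + 1))"
      using bmeas_cmult[OF f, of "1 / (C + 1)"] by simp
    ultimately show ?thesis using C(1) by (intro exI[of _ "C + 1"]) auto
  qed
  obtain C1 where C1: "bmeas M (\<lambda>x. f1 x / C1)" "\<And>x. \<bar>f1 x / C1\<bar> \<le> 1" "C1 > 0" using normalize[OF f1] by blast
  obtain C2 where C2: "bmeas M (\<lambda>x. f2 x / C2)" "\<And>x. \<bar>f2 x / C2\<bar> \<le> 1" "C2 > 0" using normalize[OF f2] by blast
  \<comment> \<open>The normalising constants are absorbed by the third function.\<close>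
  have "davg (cubic S T f1 f2 f3 x) N = davg (cubic S T (\<lambda>x. f1 x / C1) (\<lambda>x. f2 x / C2) (\<lambda>x. C1 * C2 * f3 x) x) N" for x N
    using C1(3) C2(3) by (simp add: davg_def cubic_def mult.assoc)
  then show ?thesis
    using AE_cubic_convergent_normalized[OF C1(1,2) C2(1,2) bmeas_cmult[OF f3, of "C1 * C2"]] by simp
qed

text \<open>Truncation changes f on a null set only, and the preimages of this set under the
  countably many maps S^i T^j are null; so the two functions agree along whole orbits.\<close>

lemma AE_Linfty_orbit:
  assumes "f \<in> Linfty M"
  obtains g where "bmeas M g" "AE x in M. \<forall>i j. f ((S ^^ i) ((T ^^ j) x)) = g ((S ^^ i) ((T ^^ j) x))"
proof -
  obtain C where C: "AE x in M. \<bar>f x\<bar> \<le> C" and [measurable]: "f \<in> borel_measurable M"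
    using assms by (auto simp: Linfty_def)
  define g where "g x = (if \<bar>f x\<bar> \<le> C then f x else 0)" for x
  have "bmeas M g"
  proof (rule bmeasI)
    show "g \<in> borel_measurable M" unfolding g_def[abs_def] by measurable
    show "\<bar>g x\<bar> \<le> \<bar>C\<bar>" for x by (auto simp: g_def)
  qed
  moreover have "AE x in M. f x = g x" using C by eventually_elim (simp add: g_def)
  ultimately show ?thesis using that AE_funpow_pair by blast
qed

lemma AE_cubic_Linfty_convergent:
  assumes "f1 \<in> Linfty M" "f2 \<in> Linfty M" "f3 \<in> Linfty M"
  shows "AE x in M. convergent (\<lambda>N. davg (cubic S T f1 f2 f3 x) N)"
proof -
  obtain g1 where g1: "bmeas M g1" "AE x in M. \<forall>i j. f1 ((S ^^ i) ((T ^^ j) x)) = g1 ((S ^^ i) ((T ^^ j) x))"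
    by (rule AE_Linfty_orbit[OF assms(1)])
  obtain g2 where g2: "bmeas M g2" "AE x in M. \<forall>i j. f2 ((S ^^ i) ((T ^^ j) x)) = g2 ((S ^^ i) ((T ^^ j) x))"
    by (rule AE_Linfty_orbit[OF assms(2)])
  obtain g3 where g3: "bmeas M g3" "AE x in M. \<forall>i j. f3 ((S ^^ i) ((T ^^ j) x)) = g3 ((S ^^ i) ((T ^^ j) x))"
    by (rule AE_Linfty_orbit[OF assms(3)])
  from g1(2) g2(2) g3(2) AE_cubic_convergent[OF g1(1) g2(1) g3(1)] show ?thesis
  proof eventually_elim
    case (elim x)
    \<comment> \<open>Setting one of the two exponents to 0 covers the points S^i x and T^j
      x.\<close>
    have "f1 ((S ^^ i) x) = g1 ((S ^^ i) x)" for i using elim(1)[rule_format, of i 0] by simp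
    moreover have "f2 ((T ^^ j) x) = g2 ((T ^^ j) x)" for j using elim(2)[rule_format, of 0 j] by simp
    ultimately have "cubic S T f1 f2 f3 x = cubic S T g1 g2 g3 x"
      using elim(3) by (simp add: cubic_def fun_eq_iff)
    then show ?case using elim(4) by simp
  qed
qed

end

theorem theorem1p1:
  fixes M :: "'a::polish_space measure"
    and S T :: "'a \<Rightarrow> 'a"
    and f1 f2 f3 :: "'a \<Rightarrow> real"
  assumes "prob_space M"
    and "sets M = sets borel"
    and "inv_mp_map M S" and "inv_mp_map M T"
    and "\<And>x. x \<in> space M \<Longrightarrow> S (T x) = T (S x)"
    and "ergodic2 M S T"
    and "f1 \<in> Linfty M" and "f2 \<in> Linfty M" and "f3 \<in> Linfty M"
  shows "AE x in M. convergent (\<lambda>N::nat.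
           (1 / (real N)\<^sup>2) * (\<Sum>i<N. \<Sum>j<N.
              f1 ((S ^^ i) x) * f2 ((T ^^ j) x) * f3 ((S ^^ i) ((T ^^ j) x))))"
proof -
  \<comment> \<open>The space is the whole type, so commutation and the equations for
    \<open>inv T\<close> hold at every point, as the locale demands.\<close>
  have space: "space M = UNIV" using sets_eq_imp_space_eq[OF assms(2)] by simp
  have S: "mp_map M S" and T: "mp_map M T" "mp_map M (inv T)" "bij T"
    using assms(3,4) by (auto simp: inv_mp_map_def space)
  obtain Y :: "'a \<Rightarrow> real \<Rightarrow> 'a" where Y: "(\<lambda>(x, t). Y x t) \<in> measurable (M \<Otimes>\<^sub>M unif) M"
    "\<And>x t. Y (S x) t = Y x t"
    "\<And>a b. bmeas M a \<Longrightarrow> bmeas M b \<Longrightarrow>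
       (\<integral>x. a x * (\<integral>t. b (Y x t) \<partial>unif) \<partial>M) = (\<integral>x. a x * erg S b x \<partial>M)"
    by (rule conditional_kernel[OF assms(1,2) S]) blast
  interpret self_joining M S T "inv T" Y
    using assms S T Y
    by (intro self_joining.intro self_joining_axioms.intro)
       (auto simp: space bij_is_surj surj_f_inv_f bij_is_inj)
  show ?thesis
    using AE_cubic_Linfty_convergent[OF assms(7-9)] by (simp add: davg_def cubic_def)
qed

end
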